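(* Let $G$ be a Lie group with Lie algebra $\mathfrak{g}$, let $M$ be a homogeneous $G$-space, and let $\mu$ be a $G$-invariant smooth positive density on $M$. Then for every $v\in\mathfrak{g}$ the associated vector field $\widetilde v$ on $M$ has zero divergence: $\mathrm{div}_\mu(\widetilde v)=0$.
   Context: A homogeneous $G$-space is a smooth manifold $M$ with a smooth transitive left action $(a,x)\mapsto a.x$ of $G$. For $v\in\mathfrak{g}$, $\widetilde v_x:=\frac{d}{dt}\big|_{t=0}\exp(tv).x$. A density on an $n$-dimensional real vector space $V$ is a function $\mu:V^n\to\mathbb{R}$ with $\mu(Tv_1,\dots,Tv_n)=|\det T|\,\mu(v_1,\dots,v_n)$ for every linear $T:V\to V$; it is positive if it is $>0$ on linearly independent tuples. A smooth positive density on $M$ is a smooth section of the line bundle $\mathcal{D}M=\bigsqcup_q\mathcal{D}(T_qM)$ that is positive at each point. Pullback: $(F^*\mu)_p(v_1,\dots,v_n)=\mu_{F(p)}(dF_pv_1,\dots,dF_pv_n)$. The density $\mu$ is $G$-invariant if $\ell_a^*\mu=\mu$ for all $a\in G$, where $\ell_a(x)=a.x$. The divergence of a smooth vector field $Y$ is the function $\mathrm{div}_\mu(Y)\in C^\infty(M)$ with $\mathcal{L}_Y\mu=\mathrm{div}_\mu(Y)\,\mu$, where $\mathcal{L}_Y\mu=\frac{d}{dt}\big|_{t=0}(\phi^t_Y)^*\mu$ is the Lie derivative along the flow of $Y$. *)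

theory Defs
  imports "HOL-Analysis.Analysis" "HOL-Library.Function_Algebras"
begin

section \<open>Pointwise vector space structure on functions\<close>

instantiation "fun" :: (type, real_vector) real_vector
begin

definition scaleR_fun :: "real \<Rightarrow> ('a \<Rightarrow> 'b) \<Rightarrow> 'a \<Rightarrow> 'b"
  where "scaleR_fun r f = (\<lambda>x. r *\<^sub>R f x)"

instance
  by standard (auto simp: scaleR_fun_def plus_fun_def fun_eq_iff algebra_simps)

end


section \<open>Smooth functions on open sets of a finite-dimensional vector space\<close>

text \<open>Both notions are only meant for open \<open>S\<close> and finite-dimensional \<open>'a\<close>; there,
  continuity of all directional derivatives of order at most \<open>k\<close> is the usual \<open>C\<^sup>k\<close> condition.\<close>

primrec Ck_on ::
  "nat \<Rightarrow> 'a::real_normed_vector set \<Rightarrow> ('a \<Rightarrow> 'b::real_normed_vector) \<Rightarrow> bool" where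
  "Ck_on 0 S f \<longleftrightarrow> continuous_on S f"
| "Ck_on (Suc k) S f \<longleftrightarrow>
     (\<forall>x\<in>S. f differentiable (at x)) \<and> (\<forall>v. Ck_on k S (\<lambda>x. frechet_derivative f (at x) v))"

definition smooth_on :: "'a::real_normed_vector set \<Rightarrow> ('a \<Rightarrow> 'b::real_normed_vector) \<Rightarrow> bool"
  where "smooth_on S f \<longleftrightarrow> (\<forall>k. Ck_on k S f)"


section \<open>Smooth manifolds\<close>

text \<open>A chart is a pair of its domain and its coordinate map; values of the coordinate map
  outside the domain are irrelevant.\<close>

type_synonym ('m, 'e) chart = "'m set \<times> ('m \<Rightarrow> 'e)"

abbreviation chart_dom :: "('m, 'e) chart \<Rightarrow> 'm set"
  where "chart_dom c \<equiv> fst c"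

abbreviation chart_map :: "('m, 'e) chart \<Rightarrow> 'm \<Rightarrow> 'e"
  where "chart_map c \<equiv> snd c"

definition chart_inv :: "('m, 'e) chart \<Rightarrow> 'e \<Rightarrow> 'm"
  where "chart_inv c = inv_into (chart_dom c) (chart_map c)"

text \<open>The model space \<open>'e\<close> is a finite-dimensional inner product space. The class
  \<open>euclidean_space\<close> is avoided because it excludes dimension \<open>0\<close>; completeness is automatic in
  finite dimension. The atlas need not be maximal.\<close>

locale smooth_manifold =
  fixes A :: "('m::{t2_space, second_countable_topology}, 'e::{real_inner, banach}) chart set"
  assumes finite_dim: "\<exists>B::'e set. finite B \<and> span B = UNIV"
    and covers: "(\<Union>c\<in>A. chart_dom c) = UNIV"
    and open_dom: "c \<in> A \<Longrightarrow> open (chart_dom c)"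
    and open_image: "c \<in> A \<Longrightarrow> open (chart_map c ` chart_dom c)"
    and homeo: "c \<in> A \<Longrightarrow>
      homeomorphism (chart_dom c) (chart_map c ` chart_dom c) (chart_map c) (chart_inv c)"
    and compatible: "c \<in> A \<Longrightarrow> d \<in> A \<Longrightarrow>
      smooth_on (chart_map c ` (chart_dom c \<inter> chart_dom d)) (chart_map d \<circ> chart_inv c)"

definition model_atlas :: "('e, 'e) chart set"
  where "model_atlas = {(UNIV, \<lambda>x. x)}"

definition prod_atlas ::
  "('m, 'e) chart set \<Rightarrow> ('n, 'f) chart set \<Rightarrow> ('m \<times> 'n, 'e \<times> 'f) chart set"
  where "prod_atlas A B =
    {(chart_dom c \<times> chart_dom d, map_prod (chart_map c) (chart_map d)) | c d. c \<in> A \<and> d \<in> B}"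

definition smooth_map ::
  "('m::topological_space, 'e::real_normed_vector) chart set \<Rightarrow>
   ('n::topological_space, 'f::real_normed_vector) chart set \<Rightarrow> ('m \<Rightarrow> 'n) \<Rightarrow> bool"
  where "smooth_map A B F \<longleftrightarrow> continuous_on UNIV F \<and>
    (\<forall>c\<in>A. \<forall>d\<in>B. smooth_on (chart_map c ` (chart_dom c \<inter> F -` chart_dom d))
                             (chart_map d \<circ> F \<circ> chart_inv c))"


section \<open>Tangent vectors\<close>

text \<open>A tangent vector at \<open>p\<close> is the family of its coordinate vectors in all charts around \<open>p\<close>,
  which transform by the derivatives of the transition maps; the entries at all other charts
  are set to \<open>0\<close>. The vector space operations are those of the function type.\<close>

type_synonym ('m, 'e) tvec = "('m, 'e) chart \<Rightarrow> 'e"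

definition charts_at :: "('m, 'e) chart set \<Rightarrow> 'm \<Rightarrow> ('m, 'e) chart set"
  where "charts_at A p = {c \<in> A. p \<in> chart_dom c}"

definition tangent_space ::
  "('m, 'e::real_normed_vector) chart set \<Rightarrow> 'm \<Rightarrow> ('m, 'e) tvec set"
  where "tangent_space A p = {X.
    (\<forall>c. c \<notin> charts_at A p \<longrightarrow> X c = 0) \<and>
    (\<forall>c\<in>charts_at A p. \<forall>d\<in>charts_at A p.
       X d = frechet_derivative (chart_map d \<circ> chart_inv c) (at (chart_map c p)) (X c))}"

text \<open>The tangent vector at \<open>p\<close> with coordinate vector \<open>w\<close> in the chart \<open>c\<close>.\<close>

definition coord_vec ::
  "('m, 'e::real_normed_vector) chart set \<Rightarrow> ('m, 'e) chart \<Rightarrow> 'm \<Rightarrow> 'e \<Rightarrow> ('m, 'e) tvec"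
  where "coord_vec A c p w = (\<lambda>d. if d \<in> charts_at A p
    then frechet_derivative (chart_map d \<circ> chart_inv c) (at (chart_map c p)) w else 0)"

definition differential ::
  "('m, 'e::real_normed_vector) chart set \<Rightarrow> ('n, 'f::real_normed_vector) chart set \<Rightarrow>
   ('m \<Rightarrow> 'n) \<Rightarrow> 'm \<Rightarrow> ('m, 'e) tvec \<Rightarrow> ('n, 'f) tvec"
  where "differential A B F p X = (\<lambda>d. if d \<in> charts_at B (F p)
    then (let c = (SOME c. c \<in> charts_at A p)
          in frechet_derivative (chart_map d \<circ> F \<circ> chart_inv c) (at (chart_map c p)) (X c))
    else 0)"

definition velocity ::
  "('m, 'e::real_normed_vector) chart set \<Rightarrow> (real \<Rightarrow> 'm) \<Rightarrow> real \<Rightarrow> ('m, 'e) tvec"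
  where "velocity A \<gamma> t = (\<lambda>c. if c \<in> charts_at A (\<gamma> t)
    then vector_derivative (chart_map c \<circ> \<gamma>) (at t) else 0)"


section \<open>Integral curves and flows\<close>

definition integral_curve ::
  "('m::topological_space, 'e::real_normed_vector) chart set \<Rightarrow> ('m \<Rightarrow> ('m, 'e) tvec) \<Rightarrow>
   real set \<Rightarrow> (real \<Rightarrow> 'm) \<Rightarrow> bool"
  where "integral_curve A Y I \<gamma> \<longleftrightarrow> continuous_on I \<gamma> \<and>
    (\<forall>t\<in>I. \<forall>c\<in>charts_at A (\<gamma> t).
       ((chart_map c \<circ> \<gamma>) has_vector_derivative Y (\<gamma> t) c) (at t))"

text \<open>\<open>flow A Y t x\<close> is the value at time \<open>t\<close> of the integral curve of \<open>Y\<close> starting at \<open>x\<close>;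
  it is unspecified if the maximal integral curve through \<open>x\<close> is not defined at \<open>t\<close>.\<close>

definition flow ::
  "('m::topological_space, 'e::real_normed_vector) chart set \<Rightarrow> ('m \<Rightarrow> ('m, 'e) tvec) \<Rightarrow>
   real \<Rightarrow> 'm \<Rightarrow> 'm"
  where "flow A Y t x = (THE y. \<exists>a b \<gamma>. a < 0 \<and> 0 < b \<and> t \<in> {a<..<b} \<and>
    integral_curve A Y {a<..<b} \<gamma> \<and> \<gamma> 0 = x \<and> \<gamma> t = y)"


section \<open>Densities\<close>

text \<open>Leibniz formula with respect to some basis of the finite-dimensional subspace \<open>V\<close>, for a
  linear map sending \<open>V\<close> to itself.\<close>

definition det_on :: "'v::real_vector set \<Rightarrow> ('v \<Rightarrow> 'v) \<Rightarrow> real"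
  where "det_on V T = (let B = (SOME B. independent B \<and> span B = V)
    in \<Sum>p | p permutes B. of_int (sign p) * (\<Prod>b\<in>B. representation B (T b) (p b)))"

definition tuples :: "'v::real_vector set \<Rightarrow> 'v list set"
  where "tuples V = {vs. length vs = dim V \<and> set vs \<subseteq> V}"

text \<open>A function on \<open>V\<^sup>n\<close> is a function on lists of which only the values on \<open>tuples V\<close>
  matter. Every linear map \<open>V \<rightarrow> V\<close> extends to the whole type, so it suffices to let \<open>T\<close>
  range over linear maps of the type that preserve \<open>V\<close>.\<close>

definition density_on :: "'v::real_vector set \<Rightarrow> ('v list \<Rightarrow> real) \<Rightarrow> bool"
  where "density_on V \<mu> \<longleftrightarrow>
    (\<forall>T. linear T \<and> T ` V \<subseteq> V \<longrightarrow> (\<forall>vs\<in>tuples V. \<mu> (map T vs) = \<bar>det_on V T\<bar> * \<mu> vs))"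

definition positive_density_on :: "'v::real_vector set \<Rightarrow> ('v list \<Rightarrow> real) \<Rightarrow> bool"
  where "positive_density_on V \<mu> \<longleftrightarrow> density_on V \<mu> \<and>
    (\<forall>vs\<in>tuples V. distinct vs \<and> independent (set vs) \<longrightarrow> 0 < \<mu> vs)"

type_synonym ('m, 'e) density_field = "'m \<Rightarrow> ('m, 'e) tvec list \<Rightarrow> real"

text \<open>A chart and a basis \<open>ws\<close> of the model space give a local frame of the tangent bundle, and
  evaluating densities on that frame is a local trivialization of the density bundle.\<close>

definition smooth_positive_density ::
  "('m, 'e::real_normed_vector) chart set \<Rightarrow> ('m, 'e) density_field \<Rightarrow> bool"
  where "smooth_positive_density A \<mu> \<longleftrightarrow>
    (\<forall>p. positive_density_on (tangent_space A p) (\<mu> p)) \<and>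
    (\<forall>c\<in>A. \<forall>ws. distinct ws \<and> independent (set ws) \<and> span (set ws) = (UNIV :: 'e set) \<longrightarrow>
       smooth_on (chart_map c ` chart_dom c)
         (\<lambda>y. \<mu> (chart_inv c y) (map (coord_vec A c (chart_inv c y)) ws)))"

definition pullback ::
  "('m, 'e::real_normed_vector) chart set \<Rightarrow> ('n, 'f::real_normed_vector) chart set \<Rightarrow>
   ('m \<Rightarrow> 'n) \<Rightarrow> ('n, 'f) density_field \<Rightarrow> ('m, 'e) density_field"
  where "pullback A B F \<mu> = (\<lambda>p vs. \<mu> (F p) (map (differential A B F p) vs))"

definition lie_derivative ::
  "('m::topological_space, 'e::real_normed_vector) chart set \<Rightarrow> ('m \<Rightarrow> ('m, 'e) tvec) \<Rightarrow>
   ('m, 'e) density_field \<Rightarrow> ('m, 'e) density_field"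
  where "lie_derivative A Y \<mu> = (\<lambda>p vs. deriv (\<lambda>t. pullback A A (flow A Y t) \<mu> p vs) 0)"

definition divergence ::
  "('m::topological_space, 'e::real_normed_vector) chart set \<Rightarrow> ('m, 'e) density_field \<Rightarrow>
   ('m \<Rightarrow> ('m, 'e) tvec) \<Rightarrow> 'm \<Rightarrow> real"
  where "divergence A \<mu> Y = (THE f. smooth_map A model_atlas f \<and>
    (\<forall>p. \<forall>vs\<in>tuples (tangent_space A p). lie_derivative A Y \<mu> p vs = f p * \<mu> p vs))"


section \<open>Lie groups and homogeneous spaces\<close>

locale lie_group = smooth_manifold A + Groups.group mul e ginv
  for A :: "('g::{t2_space, second_countable_topology}, 'd::{real_inner, banach}) chart set"
    and mul :: "'g \<Rightarrow> 'g \<Rightarrow> 'g" and e :: 'g and ginv :: "'g \<Rightarrow> 'g" +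
  assumes smooth_mult: "smooth_map (prod_atlas A A) A (\<lambda>(a, b). mul a b)"
    and smooth_inverse: "smooth_map A A ginv"

text \<open>The Lie algebra is the tangent space at the identity \<open>e\<close>, and \<open>exp v = \<gamma> 1\<close> for the
  one-parameter subgroup \<open>\<gamma>\<close> with \<open>\<gamma>' 0 = v\<close>.\<close>

definition lie_algebra ::
  "('g, 'd::real_normed_vector) chart set \<Rightarrow> 'g \<Rightarrow> ('g, 'd) tvec set"
  where "lie_algebra A e = tangent_space A e"

definition one_parameter_subgroup ::
  "('g::topological_space, 'd::real_normed_vector) chart set \<Rightarrow> ('g \<Rightarrow> 'g \<Rightarrow> 'g) \<Rightarrow>
   (real \<Rightarrow> 'g) \<Rightarrow> bool"
  where "one_parameter_subgroup A mul \<gamma> \<longleftrightarrow>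
    smooth_map model_atlas A \<gamma> \<and> (\<forall>s t. \<gamma> (s + t) = mul (\<gamma> s) (\<gamma> t))"

definition lie_exp ::
  "('g::topological_space, 'd::real_normed_vector) chart set \<Rightarrow> ('g \<Rightarrow> 'g \<Rightarrow> 'g) \<Rightarrow>
   ('g, 'd) tvec \<Rightarrow> 'g"
  where "lie_exp A mul v = (THE \<gamma>. one_parameter_subgroup A mul \<gamma> \<and> velocity A \<gamma> 0 = v) 1"

locale homogeneous_space = G: lie_group A mul e ginv + M: smooth_manifold B
  for A :: "('g::{t2_space, second_countable_topology}, 'd::{real_inner, banach}) chart set"
    and mul :: "'g \<Rightarrow> 'g \<Rightarrow> 'g" and e :: 'g and ginv :: "'g \<Rightarrow> 'g"
    and B :: "('m::{t2_space, second_countable_topology}, 'e::{real_inner, banach}) chart set" +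
  fixes act :: "'g \<Rightarrow> 'm \<Rightarrow> 'm"
  assumes smooth_act: "smooth_map (prod_atlas A B) B (\<lambda>(a, x). act a x)"
    and act_one: "act e x = x"
    and act_mult: "act (mul a b) x = act a (act b x)"
    and transitive: "\<exists>a. act a x = y"

definition fundamental_field ::
  "('g::topological_space, 'd::real_normed_vector) chart set \<Rightarrow> ('g \<Rightarrow> 'g \<Rightarrow> 'g) \<Rightarrow>
   ('m, 'e::real_normed_vector) chart set \<Rightarrow> ('g \<Rightarrow> 'm \<Rightarrow> 'm) \<Rightarrow>
   ('g, 'd) tvec \<Rightarrow> 'm \<Rightarrow> ('m, 'e) tvec"
  where "fundamental_field A mul B act v =
    (\<lambda>x. velocity B (\<lambda>t. act (lie_exp A mul (t *\<^sub>R v)) x) 0)"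

definition invariant_density ::
  "('m, 'e::real_normed_vector) chart set \<Rightarrow> ('g \<Rightarrow> 'm \<Rightarrow> 'm) \<Rightarrow> ('m, 'e) density_field \<Rightarrow> bool"
  where "invariant_density B act \<mu> \<longleftrightarrow>
    (\<forall>a p. \<forall>vs\<in>tuples (tangent_space B p). pullback B B (act a) \<mu> p vs = \<mu> p vs)"

end

theory Submission
  imports Defs
begin

text \<open>For \<open>v\<close> in the Lie algebra, the one-parameter subgroup \<open>\<Gamma>\<close> with \<open>\<Gamma>'(0) = v\<close> satisfies
  \<open>exp(tv) = \<Gamma>(t)\<close>, and the flow of the fundamental field is \<open>x \<mapsto> \<Gamma>(t).x\<close>. Hence the pullback of an
  invariant density under the flow does not depend on time, its Lie derivative vanishes, and
  positivity of the density forces the divergence to be zero.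

  Existence of \<open>\<Gamma>\<close> is Picard's theorem in a chart around the identity, for the left-invariant
  vector field, followed by the extension \<open>\<Gamma>(t) = \<gamma>(t/2\<^sup>n)\<close> raised to the power \<open>2\<^sup>n\<close> of the local
  homomorphism \<open>\<gamma>\<close>. No uniqueness theorem for differential equations is needed: two curves
  \<open>\<alpha>, \<beta>\<close> with the same left logarithmic derivative make \<open>\<alpha> \<beta>\<^sup>-\<^sup>1\<close> stationary, and for an integral
  curve \<open>\<gamma>\<close> of the fundamental field \<open>\<Gamma>(-t).\<gamma>(t)\<close> is stationary.\<close>

section \<open>Calculus of functions of class \<open>C\<^sup>k\<close>\<close>

lemma Ck_on_subset: "Ck_on k S f \<Longrightarrow> T \<subseteq> S \<Longrightarrow> Ck_on k T f"
  by (induction k arbitrary: f) (auto intro: continuous_on_subset)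

lemma Ck_on_Suc_imp: "Ck_on (Suc k) S f \<Longrightarrow> Ck_on k S f"
proof (induction k arbitrary: f)
  case 0
  then show ?case
    by (auto intro!: continuous_at_imp_continuous_on differentiable_imp_continuous_within)
next
  case (Suc k)
  have "Ck_on k S (\<lambda>x. frechet_derivative f (at x) v)" for v
    using Suc.prems by (intro Suc.IH) auto
  then show ?case
    using Suc.prems by auto
qed

text \<open>Openness of \<open>S\<close> turns equality on \<open>S\<close> into equality near each
  of its points, so the Frechet derivatives agree there as well.\<close>

lemma Ck_on_cong:
  assumes "open S" "\<And>x. x \<in> S \<Longrightarrow> f x = g x" "Ck_on k S f"
  shows "Ck_on k S g"
  using assms(2,3)
proof (induction k arbitrary: f g)
  case 0
  then show ?case
    by (metis Ck_on.simps(1) continuous_on_cong)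
next
  case (Suc k)
  have diff: "g differentiable (at x)" if "x \<in> S" for x
    using Suc.prems that \<open>open S\<close>
    by (metis Ck_on.simps(2) differentiable_def has_derivative_transform_within_open)
  have "Ck_on k S (\<lambda>x. frechet_derivative g (at x) v)" for v
  proof (rule Suc.IH)
    show "frechet_derivative f (at x) v = frechet_derivative g (at x) v" if "x \<in> S" for x
      using frechet_derivative_transform_within_open[of f x S g] Suc.prems \<open>open S\<close> that by simp
    show "Ck_on k S (\<lambda>x. frechet_derivative f (at x) v)"
      using Suc.prems by simp
  qed
  with diff show ?case by simp
qed

text \<open>The derivative is unique, so an explicit formula \<open>f'\<close> may stand in for the
  choice made by \<open>frechet_derivative\<close>. Most closure properties below take this
  route.\<close>

lemma Ck_on_SucI:
  assumes "open S" and deriv: "\<And>x. x \<in> S \<Longrightarrow> (f has_derivative f' x) (at x)"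
    and "\<And>v. Ck_on k S (\<lambda>x. f' x v)"
  shows "Ck_on (Suc k) S f"
proof -
  have "Ck_on k S (\<lambda>x. frechet_derivative f (at x) v)" for v
  proof (rule Ck_on_cong[OF \<open>open S\<close> _ assms(3)[of v]])
    show "f' x v = frechet_derivative f (at x) v" if "x \<in> S" for x
      using frechet_derivative_at[OF deriv[OF that]] by simp
  qed
  then show ?thesis
    using deriv by (auto simp: differentiable_def)
qed

lemma Ck_on_has_derivative:
  "Ck_on (Suc k) S f \<Longrightarrow> x \<in> S \<Longrightarrow> (f has_derivative frechet_derivative f (at x)) (at x)"
  by (simp add: frechet_derivative_works)

text \<open>Differentiability and continuity are tested point by point. This serves curves whose
  coordinate expression is understood only near each time.\<close>

lemma Ck_on_local:
  assumes "\<And>x. x \<in> S \<Longrightarrow> \<exists>T. open T \<and> x \<in> T \<and> Ck_on k T f"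
  shows "Ck_on k S f"
  using assms
proof (induction k arbitrary: f)
  case 0
  then show ?case
    by (metis Ck_on.simps(1) continuous_at_imp_continuous_on continuous_on_eq_continuous_at)
next
  case (Suc k)
  have "Ck_on k S (\<lambda>x. frechet_derivative f (at x) v)" for v
    using Suc.prems by (intro Suc.IH) (metis Ck_on.simps(2))
  with Suc.prems show ?case
    by (metis Ck_on.simps(2))
qed

lemma Ck_on_const: "Ck_on k S (\<lambda>x. c)"
  by (induction k arbitrary: c) auto

lemma Ck_on_bounded_linear_apply:
  assumes "bounded_linear L" "open S"
  shows "Ck_on k S f \<Longrightarrow> Ck_on k S (\<lambda>x. L (f x))"
proof (induction k arbitrary: f)
  case 0
  then show ?case
    by (simp add: bounded_linear.continuous_on[OF assms(1)])
next
  case (Suc k)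
  show ?case
  proof (rule Ck_on_SucI[OF \<open>open S\<close>])
    show "((\<lambda>x. L (f x)) has_derivative (\<lambda>v. L (frechet_derivative f (at x) v))) (at x)"
      if "x \<in> S" for x
      by (rule bounded_linear.has_derivative[OF assms(1) Ck_on_has_derivative[OF Suc.prems that]])
    show "Ck_on k S (\<lambda>x. L (frechet_derivative f (at x) v))" for v
      using Suc.prems by (intro Suc.IH) simp
  qed
qed

lemma Ck_on_add:
  assumes "open S"
  shows "Ck_on k S f \<Longrightarrow> Ck_on k S g \<Longrightarrow> Ck_on k S (\<lambda>x. f x + g x)"
proof (induction k arbitrary: f g)
  case 0
  then show ?case
    by (simp add: continuous_on_add)
next
  case (Suc k)
  show ?case
  proof (rule Ck_on_SucI[OF \<open>open S\<close>])
    show "((\<lambda>x. f x + g x) has_derivative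
        (\<lambda>v. frechet_derivative f (at x) v + frechet_derivative g (at x) v)) (at x)"
      if "x \<in> S" for x
      using Suc.prems that by (intro has_derivative_add Ck_on_has_derivative)
    show "Ck_on k S (\<lambda>x. frechet_derivative f (at x) v + frechet_derivative g (at x) v)" for v
      using Suc.prems by (intro Suc.IH) simp_all
  qed
qed

lemma Ck_on_sum:
  assumes "open S" "finite I" "\<And>i. i \<in> I \<Longrightarrow> Ck_on k S (f i)"
  shows "Ck_on k S (\<lambda>x. \<Sum>i\<in>I. f i x)"
  using assms(2,3) by (induction I) (auto intro: Ck_on_const Ck_on_add[OF \<open>open S\<close>])

lemma Ck_on_scaleR:
  fixes g :: "'a::real_normed_vector \<Rightarrow> real" and f :: "'a \<Rightarrow> 'b::real_normed_vector"
  assumes "open S"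
  shows "Ck_on k S g \<Longrightarrow> Ck_on k S f \<Longrightarrow> Ck_on k S (\<lambda>x. g x *\<^sub>R f x)"
proof (induction k arbitrary: f g)
  case 0
  then show ?case
    by (simp add: continuous_on_scaleR)
next
  case (Suc k)
  show ?case
  proof (rule Ck_on_SucI[OF \<open>open S\<close>])
    show "((\<lambda>x. g x *\<^sub>R f x) has_derivative
        (\<lambda>v. g x *\<^sub>R frechet_derivative f (at x) v + frechet_derivative g (at x) v *\<^sub>R f x)) (at x)"
      if "x \<in> S" for x
      using Suc.prems that by (intro has_derivative_scaleR Ck_on_has_derivative)
    show "Ck_on k S
        (\<lambda>x. g x *\<^sub>R frechet_derivative f (at x) v + frechet_derivative g (at x) v *\<^sub>R f x)" for v
      using Suc.prems
      by (intro Ck_on_add Suc.IH \<open>open S\<close> Ck_on_Suc_imp[of k S f] Ck_on_Suc_imp[of k S g]) simp_all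
  qed
qed

text \<open>Gram-Schmidt makes the spanning set orthogonal, and pairing with \<open>b\<close> then
  isolates the coefficient of \<open>b\<close>. The set \<open>C\<close> may contain
  \<open>0\<close>, whose summand vanishes. The coefficients are bounded linear in \<open>x\<close>,
  so the expansion can be used inside derivative formulas.\<close>

lemma finite_dim_orthogonal_expansion:
  assumes "\<exists>B::'e set. finite B \<and> span B = UNIV"
  obtains C :: "'e::real_inner set" where "finite C" "\<And>x. x = (\<Sum>b\<in>C. ((x \<bullet> b) / (b \<bullet> b)) *\<^sub>R b)"
proof -
  obtain C :: "'e set" where C: "finite C" "span C = UNIV" "pairwise orthogonal C"
    using assms basis_orthogonal by metis
  have "x = (\<Sum>b\<in>C. ((x \<bullet> b) / (b \<bullet> b)) *\<^sub>R b)" for x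
  proof -
    have "x \<in> span C"
      using C(2) by simp
    then obtain u where u: "x = (\<Sum>b\<in>C. u b *\<^sub>R b)"
      using span_finite[OF C(1)] by auto
    have coeff: "x \<bullet> b = u b * (b \<bullet> b)" if "b \<in> C" for b
    proof -
      have "x \<bullet> b = (\<Sum>c\<in>C. u c * (c \<bullet> b))"
        unfolding u by (simp add: inner_sum_left)
      also have "\<dots> = (\<Sum>c\<in>C. if c = b then u b * (b \<bullet> b) else 0)"
        using C(3) that by (intro sum.cong) (auto simp: pairwise_def orthogonal_def)
      also have "\<dots> = u b * (b \<bullet> b)"
        using that C(1) by simp
      finally show ?thesis .
    qed
    show ?thesis
      by (subst u, rule sum.cong) (auto simp: coeff)
  qed
  with C(1) show ?thesis by (rule that)
qed

text \<open>In the chain rule the derivative of \<open>g\<close> is taken in the moving direction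
  \<open>f' x v\<close>, while \<open>Ck_on\<close> controls fixed directions only. Expanding that
  direction over \<open>C\<close> leaves a finite sum of scalar \<open>C^k\<close> functions times
  derivatives of \<open>g\<close> in fixed directions, to which the induction hypothesis
  applies.\<close>

lemma Ck_on_compose:
  fixes g :: "'b::real_inner \<Rightarrow> 'c::real_normed_vector" and f :: "'a::real_normed_vector \<Rightarrow> 'b"
  assumes findim: "\<exists>B::'b set. finite B \<and> span B = UNIV" and "open S" and sub: "f ` S \<subseteq> T"
  shows "Ck_on k S f \<Longrightarrow> Ck_on k T g \<Longrightarrow> Ck_on k S (\<lambda>x. g (f x))"
proof (induction k arbitrary: g)
  case 0
  then show ?case
    using sub by (auto intro: continuous_on_compose2)
next
  case (Suc k)
  obtain C :: "'b set" where C: "finite C" "\<And>x. x = (\<Sum>b\<in>C. ((x \<bullet> b) / (b \<bullet> b)) *\<^sub>R b)"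
    using finite_dim_orthogonal_expansion[OF findim] by metis
  let ?f' = "\<lambda>x. frechet_derivative f (at x)" and ?g' = "\<lambda>x. frechet_derivative g (at x)"
  have g': "(g has_derivative ?g' (f x)) (at (f x))" if "x \<in> S" for x
    using Suc.prems(2) sub that by (intro Ck_on_has_derivative[of k T]) auto
  have expand: "?g' (f x) (?f' x v) =
      (\<Sum>b\<in>C. inverse (b \<bullet> b) *\<^sub>R ((?f' x v \<bullet> b) *\<^sub>R ?g' (f x) b))" if "x \<in> S" for x v
  proof -
    interpret bounded_linear "?g' (f x)"
      using g'[OF that] by (rule has_derivative_bounded_linear)
    have "?g' (f x) (?f' x v) = ?g' (f x) (\<Sum>b\<in>C. ((?f' x v \<bullet> b) / (b \<bullet> b)) *\<^sub>R b)"
      using C(2)[of "?f' x v"] by simp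
    then show ?thesis
      by (simp add: sum scaleR divide_inverse_commute)
  qed
  show ?case
  proof (rule Ck_on_SucI[OF \<open>open S\<close>])
    show "((\<lambda>x. g (f x)) has_derivative (\<lambda>v. ?g' (f x) (?f' x v))) (at x)" if "x \<in> S" for x
      using has_derivative_compose[OF Ck_on_has_derivative[OF Suc.prems(1) that] g'[OF that]] .
    show "Ck_on k S (\<lambda>x. ?g' (f x) (?f' x v))" for v
    proof (rule Ck_on_cong[OF \<open>open S\<close>])
      show "(\<Sum>b\<in>C. inverse (b \<bullet> b) *\<^sub>R ((?f' x v \<bullet> b) *\<^sub>R ?g' (f x) b)) = ?g' (f x) (?f' x v)"
        if "x \<in> S" for x
        using expand[OF that] by simp
      show "Ck_on k S (\<lambda>x. \<Sum>b\<in>C. inverse (b \<bullet> b) *\<^sub>R ((?f' x v \<bullet> b) *\<^sub>R ?g' (f x) b))"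
      proof (intro Ck_on_sum Ck_on_scaleR Ck_on_const \<open>open S\<close> C(1))
        show "Ck_on k S (\<lambda>x. ?f' x v \<bullet> b)" for b
          using Suc.prems(1)
          by (intro Ck_on_bounded_linear_apply[OF bounded_linear_inner_left \<open>open S\<close>]) simp
        show "Ck_on k S (\<lambda>x. ?g' (f x) b)" for b
          using Suc.prems by (intro Suc.IH Ck_on_Suc_imp[of k S f]) simp_all
      qed
    qed
  qed
qed

text \<open>The derivative of a slice in direction \<open>v\<close> is a slice of the derivative of
  \<open>f\<close> in the fixed direction \<open>(0, v)\<close>, so the induction closes. Slices of
  the multiplication map are coordinate expressions of translations.\<close>

lemma Ck_on_slice_right:
  fixes f :: "'a::real_normed_vector \<times> 'b::real_normed_vector \<Rightarrow> 'c::real_normed_vector"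
  assumes "open S"
  shows "Ck_on k S f \<Longrightarrow> Ck_on k {z. (a, z) \<in> S} (\<lambda>z. f (a, z))"
proof (induction k arbitrary: f)
  case 0
  then show ?case
    by (auto intro!: continuous_on_compose2[of S f] continuous_intros)
next
  case (Suc k)
  have "open {z. (a, z) \<in> S}"
    using open_vimage[OF \<open>open S\<close>, of "\<lambda>z. (a, z)"] by (simp add: vimage_def continuous_intros)
  then show ?case
  proof (rule Ck_on_SucI)
    show "((\<lambda>z. f (a, z)) has_derivative (\<lambda>v. frechet_derivative f (at (a, x)) (0, v))) (at x)"
      if "x \<in> {z. (a, z) \<in> S}" for x
      using that Suc.prems
      by (intro has_derivative_compose[of "\<lambda>z. (a, z)" "\<lambda>v. (0, v)" x UNIV f]
          Ck_on_has_derivative[of k S] has_derivative_Pair has_derivative_const has_derivative_ident) auto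
    show "Ck_on k {z. (a, z) \<in> S} (\<lambda>x. frechet_derivative f (at (a, x)) (0, v))" for v
      using Suc.IH[of "\<lambda>p. frechet_derivative f (at p) (0, v)"] Suc.prems by simp
  qed
qed

lemma Ck_on_slice_left:
  fixes f :: "'a::real_normed_vector \<times> 'b::real_normed_vector \<Rightarrow> 'c::real_normed_vector"
  assumes "open S"
  shows "Ck_on k S f \<Longrightarrow> Ck_on k {z. (z, a) \<in> S} (\<lambda>z. f (z, a))"
proof (induction k arbitrary: f)
  case 0
  then show ?case
    by (auto intro!: continuous_on_compose2[of S f] continuous_intros)
next
  case (Suc k)
  have "open {z. (z, a) \<in> S}"
    using open_vimage[OF \<open>open S\<close>, of "\<lambda>z. (z, a)"] by (simp add: vimage_def continuous_intros)
  then show ?case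
  proof (rule Ck_on_SucI)
    show "((\<lambda>z. f (z, a)) has_derivative (\<lambda>v. frechet_derivative f (at (x, a)) (v, 0))) (at x)"
      if "x \<in> {z. (z, a) \<in> S}" for x
      using that Suc.prems
      by (intro has_derivative_compose[of "\<lambda>z. (z, a)" "\<lambda>v. (v, 0)" x UNIV f]
          Ck_on_has_derivative[of k S] has_derivative_Pair has_derivative_const has_derivative_ident) auto
    show "Ck_on k {z. (z, a) \<in> S} (\<lambda>x. frechet_derivative f (at (x, a)) (v, 0))" for v
      using Suc.IH[of "\<lambda>p. frechet_derivative f (at p) (v, 0)"] Suc.prems by simp
  qed
qed

text \<open>Bootstrapping: if \<open>y\<close> is of class \<open>C^k\<close>, then so is its
  derivative \<open>F o y\<close>, and \<open>y\<close> gains one order.\<close>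

lemma Ck_on_ode_solution:
  fixes y :: "real \<Rightarrow> 'e::real_inner"
  assumes findim: "\<exists>B::'e set. finite B \<and> span B = UNIV" and "open I" and "y ` I \<subseteq> U"
    and F: "\<And>k. Ck_on k U F"
    and ode: "\<And>t. t \<in> I \<Longrightarrow> (y has_vector_derivative F (y t)) (at t)"
  shows "Ck_on k I y"
proof (induction k)
  case 0
  show ?case
    using ode by (auto intro!: continuous_at_imp_continuous_on has_vector_derivative_continuous)
next
  case (Suc k)
  show ?case
  proof (rule Ck_on_SucI[OF \<open>open I\<close>])
    show "(y has_derivative (\<lambda>v. v *\<^sub>R F (y t))) (at t)" if "t \<in> I" for t
      using ode[OF that] by (simp add: has_vector_derivative_def)
    show "Ck_on k I (\<lambda>x. v *\<^sub>R F (y x))" for v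
      by (intro Ck_on_scaleR Ck_on_const \<open>open I\<close> Ck_on_compose[OF findim _ \<open>y ` I \<subseteq> U\<close> Suc F])
  qed
qed

section \<open>Local existence for autonomous ordinary differential equations\<close>

text \<open>The mean value inequality asks for a bound on the operator norm of the derivative, while
  \<open>Ck_on\<close> gives continuity in each fixed direction. It suffices to bound the finitely
  many directions in \<open>C\<close> near \<open>y0\<close> and to expand an arbitrary vector over
  them.\<close>

lemma C1_locally_Lipschitz:
  fixes F :: "'e::real_inner \<Rightarrow> 'f::real_normed_vector"
  assumes findim: "\<exists>B::'e set. finite B \<and> span B = UNIV"
    and "open U" and F: "Ck_on (Suc 0) U F" and "y0 \<in> U"
  obtains r L where "0 < r" "0 \<le> L" "cball y0 r \<subseteq> U"
    "\<And>x y. x \<in> cball y0 r \<Longrightarrow> y \<in> cball y0 r \<Longrightarrow> norm (F x - F y) \<le> L * norm (x - y)"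
proof -
  obtain C :: "'e set" where C: "finite C" "\<And>x. x = (\<Sum>b\<in>C. ((x \<bullet> b) / (b \<bullet> b)) *\<^sub>R b)"
    using finite_dim_orthogonal_expansion[OF findim] by metis
  let ?F' = "\<lambda>x. frechet_derivative F (at x)"
  \<comment> \<open>One more than the value at \<open>y0\<close>, so that by continuity the
    derivative in direction \<open>b\<close> stays below it nearby.\<close>
  define K where "K b = norm (?F' y0 b) + 1" for b
  \<comment> \<open>By Cauchy-Schwarz the coefficient of \<open>b\<close> in \<open>w\<close> is at
    most \<open>norm w * norm b / (b \<bullet> b)\<close>.\<close>
  define L where "L = (\<Sum>b\<in>C. norm b / (b \<bullet> b) * K b)"
  have "\<forall>\<^sub>F y in nhds y0. norm (?F' y b) < K b" for b
  proof -
    have "isCont (\<lambda>y. ?F' y b) y0"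
      using F \<open>open U\<close> \<open>y0 \<in> U\<close> by (simp add: continuous_on_eq_continuous_at)
    then have "((\<lambda>y. norm (?F' y b)) \<longlongrightarrow> norm (?F' y0 b)) (nhds y0)"
      using tendsto_at_iff_tendsto_nhds[of "\<lambda>y. ?F' y b" y0]
      by (intro tendsto_norm) (simp add: continuous_at)
    then show ?thesis
      by (rule order_tendstoD) (simp add: K_def)
  qed
  then have "\<forall>\<^sub>F y in nhds y0. \<forall>b\<in>C. norm (?F' y b) < K b"
    using C(1) by (simp add: eventually_ball_finite_distrib)
  moreover have "\<forall>\<^sub>F y in nhds y0. y \<in> U"
    using \<open>open U\<close> \<open>y0 \<in> U\<close> by (rule eventually_nhds_in_open)
  ultimately have "\<forall>\<^sub>F y in nhds y0. y \<in> U \<and> (\<forall>b\<in>C. norm (?F' y b) < K b)"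
    by eventually_elim simp
  then obtain d where d: "0 < d" "\<And>y. dist y y0 < d \<Longrightarrow> y \<in> U \<and> (\<forall>b\<in>C. norm (?F' y b) < K b)"
    unfolding eventually_nhds_metric by metis
  have "0 \<le> L"
    by (auto simp: L_def K_def intro!: sum_nonneg mult_nonneg_nonneg add_nonneg_nonneg)
  \<comment> \<open>Half the radius puts the closed ball inside the open ball on which the bounds
    hold.\<close>
  have onorm_bound: "onorm (?F' y) \<le> L" if "y \<in> cball y0 (d / 2)" for y
  proof (rule onorm_bound[OF \<open>0 \<le> L\<close>])
    fix w
    have y: "y \<in> U" "\<And>b. b \<in> C \<Longrightarrow> norm (?F' y b) < K b"
      using d that by (auto simp: dist_commute)
    interpret bounded_linear "?F' y"
      using Ck_on_has_derivative[OF F y(1)] by (rule has_derivative_bounded_linear)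
    have "?F' y w = (\<Sum>b\<in>C. ((w \<bullet> b) / (b \<bullet> b)) *\<^sub>R ?F' y b)"
      by (subst C(2)[of w]) (simp add: sum scaleR)
    also have "norm \<dots> \<le> (\<Sum>b\<in>C. norm b / (b \<bullet> b) * K b * norm w)"
    proof (rule sum_norm_le)
      fix b assume "b \<in> C"
      have "norm (((w \<bullet> b) / (b \<bullet> b)) *\<^sub>R ?F' y b) = \<bar>w \<bullet> b\<bar> / (b \<bullet> b) * norm (?F' y b)"
        by simp
      also have "\<dots> \<le> (norm w * norm b) / (b \<bullet> b) * K b"
        using y(2)[OF \<open>b \<in> C\<close>]
        by (intro mult_mono divide_right_mono Cauchy_Schwarz_ineq2) auto
      finally show "norm (((w \<bullet> b) / (b \<bullet> b)) *\<^sub>R ?F' y b) \<le> norm b / (b \<bullet> b) * K b * norm w"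
        by (simp add: mult_ac)
    qed
    finally show "norm (?F' y w) \<le> L * norm w"
      by (simp add: L_def sum_distrib_right)
  qed
  show ?thesis
  proof (rule that)
    show "0 < d / 2"
      using d by simp
    show "0 \<le> L"
      by (rule \<open>0 \<le> L\<close>)
    show sub: "cball y0 (d / 2) \<subseteq> U"
      using d by (auto simp: dist_commute)
    show "norm (F x - F y) \<le> L * norm (x - y)"
      if "x \<in> cball y0 (d / 2)" "y \<in> cball y0 (d / 2)" for x y
    proof (rule differentiable_bound[OF convex_cball _ onorm_bound that])
      show "(F has_derivative ?F' z) (at z within cball y0 (d / 2))" if "z \<in> cball y0 (d / 2)" for z
        using Ck_on_has_derivative[OF F] sub that by (blast intro: has_derivative_at_withinI)
    qed
  qed
qed

lemma vector_derivative_bound: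
  fixes h :: "real \<Rightarrow> 'b::real_normed_vector"
  assumes "convex S" "\<And>t. t \<in> S \<Longrightarrow> (h has_vector_derivative h' t) (at t within S)"
    and "\<And>t. t \<in> S \<Longrightarrow> norm (h' t) \<le> B" "s \<in> S" "t \<in> S"
  shows "norm (h s - h t) \<le> B * \<bar>s - t\<bar>"
proof -
  have "norm (h s - h t) \<le> B * norm (s - t)"
  proof (rule differentiable_bound[OF \<open>convex S\<close>])
    show "(h has_derivative (\<lambda>x. x *\<^sub>R h' t)) (at t within S)" if "t \<in> S" for t
      using assms(2)[OF that] by (simp add: has_vector_derivative_def)
    show "onorm (\<lambda>x. x *\<^sub>R h' t) \<le> B" if "t \<in> S" for t
      by (rule onorm_le) (use assms(3)[OF that] in \<open>simp add: mult.commute[of B] mult_left_mono\<close>)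
  qed (use assms in auto)
  then show ?thesis by simp
qed

text \<open>Picard's theorem: the integral equation is a fixed point problem for a contraction on
  the bounded continuous functions with values in a closed ball around \<open>y0\<close>.\<close>

lemma ode_local_solution:
  fixes F :: "'e::{real_inner, banach} \<Rightarrow> 'e"
  assumes findim: "\<exists>B::'e set. finite B \<and> span B = UNIV"
    and "open U" and F: "Ck_on (Suc 0) U F" and "y0 \<in> U"
  obtains \<delta> y where "0 < \<delta>" "y 0 = y0"
    "\<And>t. \<bar>t\<bar> < \<delta> \<Longrightarrow> y t \<in> U \<and> (y has_vector_derivative F (y t)) (at t)"
proof -
  obtain r L where r: "0 < r" "0 \<le> L" "cball y0 r \<subseteq> U"
    and lip: "\<And>x y. x \<in> cball y0 r \<Longrightarrow> y \<in> cball y0 r \<Longrightarrow> norm (F x - F y) \<le> L * norm (x - y)"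
    using C1_locally_Lipschitz[OF assms] by metis
  define M where "M = norm (F y0) + L * r"
  have "0 \<le> M"
    using r by (simp add: M_def)
  have M: "norm (F x) \<le> M" if "x \<in> cball y0 r" for x
  proof -
    have "norm (F x) \<le> norm (F y0) + norm (F x - F y0)"
      using norm_triangle_sub by blast
    also have "norm (F x - F y0) \<le> L * norm (x - y0)"
      using lip[OF that, of y0] r by simp
    also have "\<dots> \<le> L * r"
      using that r by (intro mult_left_mono) (auto simp: dist_norm norm_minus_commute)
    finally show ?thesis by (simp add: M_def)
  qed
  \<comment> \<open>The first bound gives \<open>M * \<delta> \<le> r\<close>, which keeps the
    iterates in the ball; the second gives the contraction factor
    \<open>L * \<delta> \<le> 1 / 2\<close>. Adding \<open>1\<close> keeps the denominators
    positive.\<close>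
  define \<delta> where "\<delta> = min (r / (M + 1)) (1 / (2 * (L + 1)))"
  have "0 < \<delta>"
    using r \<open>0 \<le> M\<close> by (simp add: \<delta>_def)
  have "\<delta> * (M + 1) \<le> r"
    using \<open>0 \<le> M\<close> by (subst pos_le_divide_eq[symmetric]) (auto simp: \<delta>_def)
  then have \<delta>M: "M * \<delta> \<le> r"
    using \<open>0 < \<delta>\<close> by (simp add: algebra_simps)
  have "\<delta> * (2 * (L + 1)) \<le> 1"
    using r by (subst pos_le_divide_eq[symmetric]) (auto simp: \<delta>_def)
  then have \<delta>L: "L * \<delta> \<le> 1 / 2"
    using \<open>0 < \<delta>\<close> by (simp add: algebra_simps)
  have FC: "continuous_on U F"
    using Ck_on_Suc_imp[OF F] by simp
  define J where "J = {-\<delta>..\<delta>}"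
  have J: "convex J" "0 \<in> J"
    using \<open>0 < \<delta>\<close> by (auto simp: J_def)
  \<comment> \<open>Bounded continuous functions live on the whole real line; clamping time to
    \<open>J\<close> continues the iterates as constants beyond both ends.\<close>
  define cl where "cl t = max (-\<delta>) (min \<delta> t)" for t :: real
  have cl: "cl t \<in> J" "\<bar>cl t\<bar> \<le> \<delta>" for t
    using \<open>0 < \<delta>\<close> by (auto simp: J_def cl_def)
  have cl_id: "cl t = t" if "t \<in> J" for t
    using that by (auto simp: J_def cl_def)
  have cl_cont: "continuous_on UNIV cl"
    unfolding cl_def by (intro continuous_intros)
  define X where "X = PiC UNIV (\<lambda>_::real. cball y0 r)"
  have X: "f \<in> X \<longleftrightarrow> (\<forall>t. apply_bcontfun f t \<in> cball y0 r)" for f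
    by (auto simp: X_def mem_PiC_iff Pi_iff)
  \<comment> \<open>The integral starts at the left end of \<open>J\<close>. Subtracting
    \<open>G f 0\<close> in \<open>P\<close> moves the base point to \<open>0\<close>, so that both
    signs of time are treated alike.\<close>
  define G where "G f t = integral {-\<delta>..t} (\<lambda>s. F (apply_bcontfun f s))" for f t
  have G: "(G f has_vector_derivative F (apply_bcontfun f t)) (at t within J)"
    if "f \<in> X" "t \<in> J" for f t
  proof -
    have "continuous_on {-\<delta>..\<delta>} (\<lambda>s. F (apply_bcontfun f s))"
      using that(1) r X by (intro continuous_on_compose2[OF FC]) auto
    then show ?thesis
      unfolding G_def J_def
      using that(2) by (intro integral_has_vector_derivative) (auto simp: J_def)
  qed
  define P where "P f t = y0 + (G f (cl t) - G f 0)" for f t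
  have P_ball: "norm (P f t - y0) \<le> r" if "f \<in> X" for f t
  proof -
    have "norm (G f (cl t) - G f 0) \<le> M * \<bar>cl t - 0\<bar>"
      using that X M by (intro vector_derivative_bound[OF J(1) G[OF that]] cl J) auto
    also have "\<dots> \<le> M * \<delta>"
      using cl \<open>0 \<le> M\<close> by (intro mult_left_mono) auto
    finally show ?thesis
      using \<delta>M by (simp add: P_def)
  qed
  have P_cont: "continuous_on UNIV (P f)" if "f \<in> X" for f
  proof -
    have "continuous_on J (G f)"
      using G[OF that]
      by (auto simp: continuous_on_eq_continuous_within intro: has_vector_derivative_continuous)
    then show ?thesis
      unfolding P_def using cl by (intro continuous_intros continuous_on_compose2[OF _ cl_cont]) auto
  qed
  have P_apply: "apply_bcontfun (Bcontfun (P f)) = P f" if "f \<in> X" for f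
  proof (rule Bcontfun_inverse)
    have "P f t \<in> cball y0 r" for t
      using P_ball[OF that] by (simp add: dist_norm norm_minus_commute)
    then have "range (P f) \<subseteq> cball y0 r"
      by auto
    then show "P f \<in> bcontfun"
      using P_cont[OF that] bounded_cball bounded_subset by (auto simp: bcontfun_def)
  qed
  have "\<exists>!f\<in>X. Bcontfun (P f) = f"
  proof (rule Banach_fix[where c = "1 / 2"])
    show "complete X"
      unfolding X_def complete_eq_closed by (intro closed_PiC) simp
    have "const_bcontfun y0 \<in> X"
      using r by (simp add: X const_bcontfun.rep_eq)
    then show "X \<noteq> {}"
      by blast
    show "(\<lambda>f. Bcontfun (P f)) ` X \<subseteq> X"
      using P_ball by (auto simp: X P_apply dist_norm norm_minus_commute)
    show "dist (Bcontfun (P f)) (Bcontfun (P g)) \<le> 1 / 2 * dist f g" if "f \<in> X" "g \<in> X" for f g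
    proof (rule dist_bound)
      fix t
      let ?h = "\<lambda>t. G f t - G g t"
      have deriv: "(?h has_vector_derivative F (apply_bcontfun f s) - F (apply_bcontfun g s))
          (at s within J)" if "s \<in> J" for s
        using G \<open>f \<in> X\<close> \<open>g \<in> X\<close> that by (intro has_vector_derivative_diff)
      have bound: "norm (F (apply_bcontfun f s) - F (apply_bcontfun g s)) \<le> L * dist f g" for s
      proof -
        have "norm (F (apply_bcontfun f s) - F (apply_bcontfun g s))
            \<le> L * dist (apply_bcontfun f s) (apply_bcontfun g s)"
          unfolding dist_norm using that X by (intro lip) blast+
        also have "\<dots> \<le> L * dist f g"
          using r by (intro mult_left_mono dist_bounded)
        finally show ?thesis .
      qed
      have "dist (P f t) (P g t) = norm (?h (cl t) - ?h 0)"
        by (simp add: P_def dist_norm algebra_simps)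
      also have "\<dots> \<le> L * dist f g * \<bar>cl t - 0\<bar>"
        by (rule vector_derivative_bound[OF J(1) deriv bound cl(1) J(2)])
      also have "\<dots> \<le> L * dist f g * \<delta>"
        using cl r by (intro mult_left_mono) auto
      also have "\<dots> = L * \<delta> * dist f g"
        by simp
      also have "\<dots> \<le> 1 / 2 * dist f g"
        using \<delta>L by (intro mult_right_mono) auto
      finally show "dist (apply_bcontfun (Bcontfun (P f)) t) (apply_bcontfun (Bcontfun (P g)) t)
          \<le> 1 / 2 * dist f g"
        using that by (simp add: P_apply)
    qed
  qed auto
  then obtain f where f: "f \<in> X" "Bcontfun (P f) = f"
    by blast
  define y where "y = apply_bcontfun f"
  have y_eq: "y t = y0 + (G f (cl t) - G f 0)" for t
    using P_apply[OF f(1)] f(2) by (simp add: y_def P_def fun_eq_iff)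
  show ?thesis
  proof (rule that[OF \<open>0 < \<delta>\<close>])
    show "y 0 = y0"
      using cl_id J by (simp add: y_eq)
    fix t :: real
    assume t: "\<bar>t\<bar> < \<delta>"
    then have "t \<in> J" "t \<in> {-\<delta><..<\<delta>}" "{-\<delta><..<\<delta>} \<subseteq> J"
      by (auto simp: J_def)
    then have "(G f has_vector_derivative F (y t)) (at t)"
      using G[OF f(1) \<open>t \<in> J\<close>] t
      by (metis J_def at_within_Icc_at greaterThanLessThan_iff y_def)
    then have "((\<lambda>t. y0 + (G f t - G f 0)) has_vector_derivative F (y t)) (at t)"
      by (auto intro!: derivative_eq_intros)
    \<comment> \<open>Inside \<open>J\<close> the clamping is the identity, so near \<open>t\<close>
      the fixed point coincides with the integral formula.\<close>
    then have "(y has_vector_derivative F (y t)) (at t)"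
      by (rule has_vector_derivative_transform_within_open[of _ _ _ "{-\<delta><..<\<delta>}"])
        (use \<open>t \<in> {-\<delta><..<\<delta>}\<close> \<open>{-\<delta><..<\<delta>} \<subseteq> J\<close> cl_id in \<open>auto simp: y_eq\<close>)
    moreover have "y t \<in> U"
      using f(1) r by (auto simp: X y_def)
    ultimately show "y t \<in> U \<and> (y has_vector_derivative F (y t)) (at t)"
      by simp
  qed
qed

section \<open>Velocities of curves in charts\<close>

text \<open>The conditions on a single chart, separated from its atlas so that they can be proved
  for product charts directly.\<close>

definition is_chart :: "('m::topological_space, 'e::topological_space) chart \<Rightarrow> bool"
  where "is_chart c \<longleftrightarrow> open (chart_dom c) \<and> open (chart_map c ` chart_dom c) \<and>
    homeomorphism (chart_dom c) (chart_map c ` chart_dom c) (chart_map c) (chart_inv c)"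

text \<open>A relation, because \<open>vector_derivative\<close> has an arbitrary value where no
  derivative exists. Continuity is included since a chart map has arbitrary values outside its
  domain: a differentiable coordinate expression alone would not keep the curve in the domain near
  \<open>t\<close>.\<close>

definition has_coord_velocity ::
  "('m::topological_space, 'e::real_normed_vector) chart \<Rightarrow> (real \<Rightarrow> 'm) \<Rightarrow> real \<Rightarrow> 'e \<Rightarrow> bool"
  where "has_coord_velocity c \<gamma> t w \<longleftrightarrow> isCont \<gamma> t \<and> \<gamma> t \<in> chart_dom c \<and>
    ((chart_map c \<circ> \<gamma>) has_vector_derivative w) (at t)"

abbreviation prod_chart :: "('m, 'e) chart \<Rightarrow> ('n, 'f) chart \<Rightarrow> ('m \<times> 'n, 'e \<times> 'f) chart"
  where "prod_chart c d \<equiv> (chart_dom c \<times> chart_dom d, map_prod (chart_map c) (chart_map d))"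

lemma (in smooth_manifold) is_chart: "c \<in> A \<Longrightarrow> is_chart c"
  by (simp add: is_chart_def open_dom open_image homeo)

lemma (in smooth_manifold) chart_exists: obtains c where "c \<in> A" "p \<in> chart_dom c"
  using covers by (metis UNIV_I UN_E)

lemma is_chart_inv: "is_chart c \<Longrightarrow> p \<in> chart_dom c \<Longrightarrow> chart_inv c (chart_map c p) = p"
  by (simp add: is_chart_def homeomorphism_def)

lemma is_chart_inj: "is_chart c \<Longrightarrow> inj_on (chart_map c) (chart_dom c)"
  by (metis inj_on_inverseI is_chart_inv)

text \<open>The inverse of the product chart is an \<open>inv_into\<close> of its own. Injectivity
  identifies it on the image with the pair of the two inverses, and continuity follows.\<close>

lemma is_chart_prod:
  assumes "is_chart c" "is_chart d"
  shows "is_chart (prod_chart c d)"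
proof -
  have im: "map_prod (chart_map c) (chart_map d) ` (chart_dom c \<times> chart_dom d) =
      chart_map c ` chart_dom c \<times> chart_map d ` chart_dom d"
    by force
  have inj: "inj_on (map_prod (chart_map c) (chart_map d)) (chart_dom c \<times> chart_dom d)"
    using assms by (intro map_prod_inj_on is_chart_inj)
  have inv: "chart_inv (prod_chart c d) (map_prod (chart_map c) (chart_map d) p) = p"
    if "p \<in> chart_dom c \<times> chart_dom d" for p
    using inv_into_f_f[OF inj that] by (simp add: chart_inv_def)
  have inv_eq: "chart_inv (prod_chart c d) q = (chart_inv c (fst q), chart_inv d (snd q))"
    if q: "q \<in> chart_map c ` chart_dom c \<times> chart_map d ` chart_dom d" for q
  proof -
    obtain x y where xy: "q = (chart_map c x, chart_map d y)" "x \<in> chart_dom c" "y \<in> chart_dom d"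
      using q by (cases q) auto
    then show ?thesis
      using inv[of "(x, y)"] is_chart_inv[OF assms(1) xy(2)] is_chart_inv[OF assms(2) xy(3)] by simp
  qed
  have cont: "continuous_on (chart_map c ` chart_dom c) (chart_inv c)"
    "continuous_on (chart_map d ` chart_dom d) (chart_inv d)"
    "continuous_on (chart_dom c) (chart_map c)" "continuous_on (chart_dom d) (chart_map d)"
    using assms by (auto simp: is_chart_def homeomorphism_def)
  have "continuous_on (chart_map c ` chart_dom c \<times> chart_map d ` chart_dom d)
      (\<lambda>q. (chart_inv c (fst q), chart_inv d (snd q)))"
    by (intro continuous_on_Pair continuous_on_compose2[OF cont(1) continuous_on_fst]
        continuous_on_compose2[OF cont(2) continuous_on_snd] continuous_on_id) auto
  then have "continuous_on (chart_map c ` chart_dom c \<times> chart_map d ` chart_dom d)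
      (chart_inv (prod_chart c d))"
    by (rule continuous_on_eq) (simp add: inv_eq)
  moreover have "continuous_on (chart_dom c \<times> chart_dom d) (map_prod (chart_map c) (chart_map d))"
    unfolding map_prod_def case_prod_beta'
    by (intro continuous_on_Pair continuous_on_compose2[OF cont(3) continuous_on_fst]
        continuous_on_compose2[OF cont(4) continuous_on_snd] continuous_on_id) auto
  moreover have "chart_inv (prod_chart c d) ` (chart_map c ` chart_dom c \<times> chart_map d ` chart_dom d)
      = chart_dom c \<times> chart_dom d"
    unfolding im[symmetric] image_image using inv by (simp cong: image_cong_simp)
  moreover have "map_prod (chart_map c) (chart_map d) (chart_inv (prod_chart c d) q) = q"
    if "q \<in> chart_map c ` chart_dom c \<times> chart_map d ` chart_dom d" for q
    using that inv unfolding im[symmetric] by (metis (no_types, lifting) imageE)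
  ultimately have "homeomorphism (chart_dom c \<times> chart_dom d)
      (chart_map c ` chart_dom c \<times> chart_map d ` chart_dom d)
      (map_prod (chart_map c) (chart_map d)) (chart_inv (prod_chart c d))"
    unfolding homeomorphism_def using inv im by blast
  then show ?thesis
    using assms by (simp add: is_chart_def im open_Times)
qed

lemma open_chart_image:
  assumes "is_chart c" "open V"
  shows "open (chart_map c ` (chart_dom c \<inter> V))"
proof -
  have "chart_map c ` (chart_dom c \<inter> V) = chart_map c ` chart_dom c \<inter> chart_inv c -` V"
    by (auto simp: is_chart_inv[OF assms(1)])
  moreover have "open (chart_map c ` chart_dom c \<inter> chart_inv c -` V)"
    using assms by (intro continuous_open_preimage) (auto simp: is_chart_def homeomorphism_def)
  ultimately show ?thesis by simp
qed

lemma isCont_chart_inv: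
  assumes "is_chart c" "z \<in> chart_map c ` chart_dom c"
  shows "isCont (chart_inv c) z"
  using assms continuous_on_eq_continuous_at[of "chart_map c ` chart_dom c" "chart_inv c"]
  by (auto simp: is_chart_def homeomorphism_def)

text \<open>A straight line in coordinates, carried back to the manifold, realizes an arbitrary
  coordinate vector as a velocity.\<close>

lemma coord_line_velocity:
  assumes "is_chart c" "p \<in> chart_dom c"
  obtains \<beta> where "\<beta> 0 = p" "has_coord_velocity c \<beta> 0 w"
proof
  let ?l = "\<lambda>h. chart_map c p + h *\<^sub>R w" and ?U = "chart_map c ` chart_dom c"
  have "open ?U"
    using assms by (simp add: is_chart_def)
  have "?l 0 \<in> ?U"
    using assms by simp
  have l: "(?l has_vector_derivative w) (at 0)"
    by (auto intro!: derivative_eq_intros)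
  show eq0: "chart_inv c (?l 0) = p"
    using is_chart_inv[OF assms] by simp
  have "open (?l -` ?U)"
    by (intro open_vimage \<open>open ?U\<close> continuous_intros)
  then have "((chart_map c \<circ> (\<lambda>h. chart_inv c (?l h))) has_vector_derivative w) (at 0)"
    by (rule has_vector_derivative_transform_within_open[OF l])
      (use assms is_chart_inv[OF assms(1)] in auto)
  moreover have "isCont (\<lambda>h. chart_inv c (?l h)) 0"
    using isCont_chart_inv[OF assms(1) \<open>?l 0 \<in> ?U\<close>]
    by (rule isCont_o2[OF has_vector_derivative_continuous[OF l]])
  ultimately show "has_coord_velocity c (\<lambda>h. chart_inv c (?l h)) 0 w"
    using assms(2) eq0 by (simp add: has_coord_velocity_def)
qed

lemma eventually_in_chart_dom:
  assumes "is_chart c" "has_coord_velocity c \<gamma> t w"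
  shows "\<forall>\<^sub>F s in nhds t. \<gamma> s \<in> chart_dom c"
  using assms topological_tendstoD[of \<gamma> "\<gamma> t" "at t" "chart_dom c"]
  by (simp add: eventually_nhds_conv_at isCont_def is_chart_def has_coord_velocity_def)

lemma has_coord_velocity_const: "p \<in> chart_dom c \<Longrightarrow> has_coord_velocity c (\<lambda>_. p) t 0"
  by (simp add: has_coord_velocity_def o_def)

lemma has_coord_velocity_unique:
  "has_coord_velocity c \<gamma> t w \<Longrightarrow> has_coord_velocity c \<gamma> t w' \<Longrightarrow> w = w'"
  unfolding has_coord_velocity_def by (blast intro: vector_derivative_unique_at)

lemma has_coord_velocity_transform:
  assumes "has_coord_velocity c \<gamma> t w" "open T" "t \<in> T" "\<And>s. s \<in> T \<Longrightarrow> \<gamma> s = \<gamma>' s"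
  shows "has_coord_velocity c \<gamma>' t w"
proof -
  have "\<forall>\<^sub>F s in nhds t. \<gamma> s = \<gamma>' s"
    using assms(2-4) eventually_nhds by blast
  then have "isCont \<gamma>' t"
    using assms(1) isCont_cong unfolding has_coord_velocity_def by blast
  moreover have "((chart_map c \<circ> \<gamma>') has_vector_derivative w) (at t)"
    using assms unfolding has_coord_velocity_def
    by (auto intro: has_vector_derivative_transform_within_open[of "chart_map c \<circ> \<gamma>" _ _ T])
  ultimately show ?thesis
    using assms by (simp add: has_coord_velocity_def)
qed

lemma has_coord_velocity_affine:
  assumes "has_coord_velocity c \<gamma> (r * t + s) w"
  shows "has_coord_velocity c (\<lambda>h. \<gamma> (r * h + s)) t (r *\<^sub>R w)"
proof -
  let ?l = "\<lambda>h. r * h + s"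
  have l: "(?l has_vector_derivative r) (at t)"
    by (auto intro!: derivative_eq_intros simp: has_real_derivative_iff_has_vector_derivative[symmetric])
  have "((chart_map c \<circ> \<gamma>) \<circ> ?l has_vector_derivative r *\<^sub>R w) (at t)"
    using assms l unfolding has_coord_velocity_def by (intro vector_diff_chain_at) auto
  moreover have "isCont (\<lambda>h. \<gamma> (?l h)) t"
    using assms has_vector_derivative_continuous[OF l] isCont_o2[of t ?l \<gamma>]
    unfolding has_coord_velocity_def by simp
  ultimately show ?thesis
    using assms by (simp add: has_coord_velocity_def o_def)
qed

lemma has_coord_velocity_shift:
  "has_coord_velocity c (\<lambda>h. \<gamma> (t + h)) 0 w \<longleftrightarrow> has_coord_velocity c \<gamma> t w"
  using has_coord_velocity_affine[of c \<gamma> 1 0 t w]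
    has_coord_velocity_affine[of c "\<lambda>h. \<gamma> (t + h)" 1 t "-t" w]
  by (auto simp: add.commute)

lemma has_coord_velocity_Pair:
  assumes "has_coord_velocity c \<alpha> t w" "has_coord_velocity d \<beta> t z"
  shows "has_coord_velocity (prod_chart c d) (\<lambda>s. (\<alpha> s, \<beta> s)) t (w, z)"
proof -
  have "((\<lambda>s. (chart_map c (\<alpha> s), chart_map d (\<beta> s))) has_vector_derivative (w, z)) (at t)"
    using assms unfolding has_coord_velocity_def by (intro has_vector_derivative_Pair) (auto simp: o_def)
  then show ?thesis
    using assms by (simp add: has_coord_velocity_def o_def)
qed

section \<open>Chain rules for velocities, and stationary curves\<close>

abbreviation chart_deriv ::
  "('m, 'e::real_normed_vector) chart \<Rightarrow> ('n, 'f::real_normed_vector) chart \<Rightarrow> ('m \<Rightarrow> 'n) \<Rightarrow> 'm \<Rightarrow>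
    'e \<Rightarrow> 'f"
  where "chart_deriv c d F p \<equiv>
    frechet_derivative (chart_map d \<circ> F \<circ> chart_inv c) (at (chart_map c p))"

lemma smooth_map_has_derivative:
  assumes "smooth_map A B F" "c \<in> A" "d \<in> B" "p \<in> chart_dom c" "F p \<in> chart_dom d"
  shows "((chart_map d \<circ> F \<circ> chart_inv c) has_derivative chart_deriv c d F p) (at (chart_map c p))"
proof (rule Ck_on_has_derivative)
  show "Ck_on (Suc 0) (chart_map c ` (chart_dom c \<inter> F -` chart_dom d))
      (chart_map d \<circ> F \<circ> chart_inv c)"
    using assms unfolding smooth_map_def smooth_on_def by blast
qed (use assms in auto)

lemma has_coord_velocity_map:
  assumes F: "smooth_map A B F" "c \<in> A" "d \<in> B" "F (\<gamma> t) \<in> chart_dom d"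
    and "is_chart c" and vel: "has_coord_velocity c \<gamma> t w"
  shows "has_coord_velocity d (\<lambda>s. F (\<gamma> s)) t (chart_deriv c d F (\<gamma> t) w)"
proof -
  have vel': "isCont \<gamma> t" "\<gamma> t \<in> chart_dom c"
    "((chart_map c \<circ> \<gamma>) has_vector_derivative w) (at t)"
    using vel by (auto simp: has_coord_velocity_def)
  have "isCont (\<lambda>s. F (\<gamma> s)) t"
    using continuous_on_tendsto_compose[of UNIV F \<gamma> "\<gamma> t" "at t"] F(1) vel'(1)
    by (simp add: smooth_map_def isCont_def)
  moreover have "((chart_map d \<circ> (\<lambda>s. F (\<gamma> s))) has_vector_derivative chart_deriv c d F (\<gamma> t) w) (at t)"
  proof -
    \<comment> \<open>Only while \<open>\<gamma>\<close> stays in the domain of \<open>c\<close>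
      does \<open>chart_inv c\<close> cancel in the composite of coordinate expressions.\<close>
    obtain T where T: "open T" "t \<in> T" "\<And>s. s \<in> T \<Longrightarrow> \<gamma> s \<in> chart_dom c"
      using eventually_in_chart_dom[OF \<open>is_chart c\<close> vel] unfolding eventually_nhds by blast
    have "(((chart_map d \<circ> F \<circ> chart_inv c) \<circ> (chart_map c \<circ> \<gamma>))
        has_vector_derivative chart_deriv c d F (\<gamma> t) w) (at t)"
      by (rule vector_derivative_diff_chain_within[OF vel'(3) has_derivative_at_withinI])
        (use smooth_map_has_derivative[OF F(1-3) vel'(2) F(4)] in \<open>simp add: o_def\<close>)
    then show ?thesis
      by (rule has_vector_derivative_transform_within_open[OF _ T(1,2)])
        (simp add: is_chart_inv[OF \<open>is_chart c\<close>] T(3))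
  qed
  ultimately show ?thesis
    using F(4) by (simp add: has_coord_velocity_def)
qed

text \<open>The resulting velocity depends only on the points reached at \<open>t\<close> and on the
  pair \<open>(w, z)\<close>. Comparing curves with equal velocities therefore replaces explicit
  formulas for the derivatives of multiplication, inversion and action.\<close>

lemma has_coord_velocity_map2:
  assumes F: "smooth_map (prod_atlas A B) C (\<lambda>(a, b). F a b)" "c \<in> A" "d \<in> B" "k \<in> C"
      "F (\<alpha> t) (\<beta> t) \<in> chart_dom k"
    and "is_chart c" "is_chart d"
    and vel: "has_coord_velocity c \<alpha> t w" "has_coord_velocity d \<beta> t z"
  shows "has_coord_velocity k (\<lambda>s. F (\<alpha> s) (\<beta> s)) t
    (chart_deriv (prod_chart c d) k (\<lambda>(a, b). F a b) (\<alpha> t, \<beta> t) (w, z))"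
proof -
  have "prod_chart c d \<in> prod_atlas A B"
    using F(2,3) unfolding prod_atlas_def by blast
  from has_coord_velocity_map[OF F(1) this F(4) _ is_chart_prod has_coord_velocity_Pair[OF vel]]
  show ?thesis
    using assms by simp
qed

lemma linear_chart_deriv2:
  assumes F: "smooth_map (prod_atlas A B) C (\<lambda>(a, b). F a b)" "c \<in> A" "d \<in> B" "k \<in> C"
    and "p \<in> chart_dom c" "q \<in> chart_dom d" "F p q \<in> chart_dom k"
  shows "linear (chart_deriv (prod_chart c d) k (\<lambda>(a, b). F a b) (p, q))"
proof -
  have "prod_chart c d \<in> prod_atlas A B"
    using F(2,3) unfolding prod_atlas_def by blast
  from smooth_map_has_derivative[OF F(1) this F(4), of "(p, q)"] assms show ?thesis
    by (auto dest: has_derivative_linear)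
qed

lemma (in smooth_manifold) smooth_map_ident: "smooth_map A A (\<lambda>x. x)"
  using compatible by (auto simp: smooth_map_def o_def vimage_def)

text \<open>Near each time the curve lies in one chart, where its coordinates have derivative zero
  on a ball and are constant; the chart is injective, so the curve is locally constant, and
  connectedness does the rest.\<close>

lemma (in smooth_manifold) zero_velocity_imp_constant:
  assumes "open I" "connected I" "s \<in> I" "t \<in> I"
    and zero: "\<And>t. t \<in> I \<Longrightarrow> \<exists>c\<in>A. has_coord_velocity c \<delta> t 0"
  shows "\<delta> s = \<delta> t"
proof (rule connected_local_const[OF assms(2-4)], rule ballI)
  fix t assume "t \<in> I"
  then obtain c where c: "c \<in> A" "has_coord_velocity c \<delta> t 0"
    using zero by blast
  then have "\<forall>\<^sub>F s in nhds t. \<delta> s \<in> chart_dom c"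
    by (intro eventually_in_chart_dom is_chart)
  moreover have "\<forall>\<^sub>F s in nhds t. s \<in> I"
    using \<open>open I\<close> \<open>t \<in> I\<close> by (rule eventually_nhds_in_open)
  ultimately have "\<forall>\<^sub>F s in nhds t. s \<in> I \<and> \<delta> s \<in> chart_dom c"
    by eventually_elim simp
  then obtain r where r: "0 < r" "\<And>s. dist s t < r \<Longrightarrow> s \<in> I \<and> \<delta> s \<in> chart_dom c"
    unfolding eventually_nhds_metric by blast
  have "((chart_map c \<circ> \<delta>) has_vector_derivative 0) (at s within ball t r)" if "s \<in> ball t r" for s
  proof -
    have s: "s \<in> I" "\<delta> s \<in> chart_dom c"
      using r that by (auto simp: dist_commute)
    \<comment> \<open>The hypothesis may offer a different chart at each time. The derivative of the
      transition map is linear, so zero velocity in \<open>d\<close> is zero velocity in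
      \<open>c\<close>.\<close>
    obtain d where d: "d \<in> A" "has_coord_velocity d \<delta> s 0"
      using zero s by blast
    then have "\<delta> s \<in> chart_dom d"
      by (simp add: has_coord_velocity_def)
    from smooth_map_has_derivative[OF smooth_map_ident d(1) c(1) this s(2)]
    have "chart_deriv d c (\<lambda>x. x) (\<delta> s) 0 = 0"
      by (intro linear_0 has_derivative_linear)
    then have "has_coord_velocity c \<delta> s 0"
      using has_coord_velocity_map[OF smooth_map_ident d(1) c(1) s(2) is_chart[OF d(1)] d(2)] by simp
    then show ?thesis
      by (auto simp: has_coord_velocity_def intro: has_vector_derivative_at_within)
  qed
  then obtain k where "\<And>s. s \<in> ball t r \<Longrightarrow> (chart_map c \<circ> \<delta>) s = k"
    using has_vector_derivative_zero_constant[OF convex_ball] by metis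
  then have "chart_map c (\<delta> t) = chart_map c (\<delta> s)" if "dist s t < r" for s
    using that r(1) by (simp add: dist_commute)
  then have "\<delta> t = \<delta> s" if "dist s t < r" for s
    using inj_onD[OF is_chart_inj[OF is_chart[OF c(1)]]] r that by simp
  then show "\<forall>\<^sub>F s in at t within I. \<delta> t = \<delta> s"
    unfolding eventually_at using r(1) by blast
qed

section \<open>One-parameter subgroups\<close>

lemma linear_0_Pair: "linear f \<Longrightarrow> f (0, 0) = 0"
  by (metis linear_0 zero_prod_def)

context lie_group
begin

text \<open>\<open>left_velocity c \<alpha> t w\<close> says that \<open>w\<close> is the coordinate vector in \<open>c\<close> of the left
  logarithmic derivative \<open>\<alpha>(t)\<^sup>-\<^sup>1 \<alpha>'(t)\<close>.\<close>

definition left_velocity :: "('g, 'd) chart \<Rightarrow> (real \<Rightarrow> 'g) \<Rightarrow> real \<Rightarrow> 'd \<Rightarrow> bool"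
  where "left_velocity c \<alpha> t w \<longleftrightarrow> has_coord_velocity c (\<lambda>h. mul (ginv (\<alpha> t)) (\<alpha> (t + h))) 0 w"

lemma mul_inverse_cancel [simp]: "mul (ginv a) (mul a b) = b" "mul a (mul (ginv a) b) = b"
  by (simp_all flip: assoc)

text \<open>With \<open>a\<close> and \<open>b\<close> the two curves translated back to
  \<open>e\<close>, the quotient at time \<open>t + h\<close> is \<open>\<alpha> t\<close> times
  \<open>a h\<close> times \<open>ginv (b h)\<close> times \<open>ginv (\<beta> t)\<close>. Both
  \<open>a\<close> and \<open>b\<close> leave \<open>e\<close> with velocity \<open>w\<close>, so
  the velocity of the middle factor is a vector \<open>z\<close> that does not depend on which
  curves are taken.\<close>

lemma left_velocity_unique:
  assumes c: "c \<in> A" "e \<in> chart_dom c" and I: "open I" "connected I" "s \<in> I" "t \<in> I"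
    and vel: "\<And>t. t \<in> I \<Longrightarrow> left_velocity c \<alpha> t w" "\<And>t. t \<in> I \<Longrightarrow> left_velocity c \<beta> t w"
  shows "mul (\<alpha> s) (ginv (\<beta> s)) = mul (\<alpha> t) (ginv (\<beta> t))"
proof (rule zero_velocity_imp_constant[OF I])
  fix t assume "t \<in> I"
  define a where "a h = mul (ginv (\<alpha> t)) (\<alpha> (t + h))" for h
  define b where "b h = mul (ginv (\<beta> t)) (\<beta> (t + h))" for h
  have ab: "has_coord_velocity c a 0 w" "has_coord_velocity c b 0 w"
    using vel[OF \<open>t \<in> I\<close>] by (simp_all add: left_velocity_def a_def[abs_def] b_def[abs_def])
  have ab0: "a 0 = e" "b 0 = e"
    by (simp_all add: a_def b_def)
  define w' where "w' = chart_deriv c c ginv e w"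
  have inv: "has_coord_velocity c (\<lambda>h. ginv (f h)) 0 w'"
    if "has_coord_velocity c f 0 w" "f 0 = e" for f
    using has_coord_velocity_map[OF smooth_inverse c(1,1) _ is_chart[OF c(1)] that(1)] that(2) c(2)
    by (simp add: w'_def)
  define z where "z = chart_deriv (prod_chart c c) c (\<lambda>(a, b). mul a b) (e, e) (w, w')"
  have quot: "has_coord_velocity c (\<lambda>h. mul (f h) (ginv (g h))) 0 z"
    if "has_coord_velocity c f 0 w" "f 0 = e" "has_coord_velocity c g 0 w" "g 0 = e" for f g
    using has_coord_velocity_map2[OF smooth_mult c(1,1,1) _ is_chart[OF c(1)] is_chart[OF c(1)]
        that(1) inv[OF that(3,4)]] that c(2)
    by (simp add: z_def)
  \<comment> \<open>The quotient of a curve by itself is constant, which determines \<open>z\<close>.\<close>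
  have "z = 0"
    using quot[OF ab(1) ab0(1) ab(1) ab0(1)] has_coord_velocity_const[OF c(2), of 0]
    by (auto intro: has_coord_velocity_unique)
  then have q: "has_coord_velocity c (\<lambda>h. mul (a h) (ginv (b h))) 0 0"
    using quot ab ab0 by simp
  \<comment> \<open>Multiplication by the constants \<open>ginv (\<beta> t)\<close> on the right and
    \<open>\<alpha> t\<close> on the left acts linearly on velocities and keeps velocity
    zero.\<close>
  obtain c1 where c1: "c1 \<in> A" "\<alpha> t \<in> chart_dom c1" by (rule chart_exists)
  obtain c2 where c2: "c2 \<in> A" "ginv (\<beta> t) \<in> chart_dom c2" by (rule chart_exists)
  obtain k where k: "k \<in> A" "mul (\<alpha> t) (ginv (\<beta> t)) \<in> chart_dom k" by (rule chart_exists)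
  have "chart_deriv (prod_chart c c2) c2 (\<lambda>(a, b). mul a b) (e, ginv (\<beta> t)) (0, 0) = 0"
    using c2 c by (intro linear_0_Pair linear_chart_deriv2[OF smooth_mult]) auto
  then have "has_coord_velocity c2 (\<lambda>h. mul (mul (a h) (ginv (b h))) (ginv (\<beta> t))) 0 0"
    using has_coord_velocity_map2[OF smooth_mult c(1) c2(1,1) _ is_chart[OF c(1)] is_chart[OF c2(1)]
        q has_coord_velocity_const[OF c2(2)]] c2(2) by (simp add: ab0)
  moreover have "chart_deriv (prod_chart c1 c2) k (\<lambda>(a, b). mul a b) (\<alpha> t, ginv (\<beta> t)) (0, 0) = 0"
    using c1 c2 k by (intro linear_0_Pair linear_chart_deriv2[OF smooth_mult]) auto
  ultimately have "has_coord_velocity k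
      (\<lambda>h. mul (\<alpha> t) (mul (mul (a h) (ginv (b h))) (ginv (\<beta> t)))) 0 0"
    using has_coord_velocity_map2[OF smooth_mult c1(1) c2(1) k(1) _ is_chart[OF c1(1)]
        is_chart[OF c2(1)] has_coord_velocity_const[OF c1(2)], where t = 0
          and \<beta> = "\<lambda>h. mul (mul (a h) (ginv (b h))) (ginv (\<beta> t))" and z = 0] k(2)
    by (simp add: ab0)
  then have "has_coord_velocity k (\<lambda>h. mul (\<alpha> (t + h)) (ginv (\<beta> (t + h)))) 0 0"
    by (simp add: a_def b_def inverse_distrib_swap assoc)
  then show "\<exists>c\<in>A. has_coord_velocity c (\<lambda>t. mul (\<alpha> t) (ginv (\<beta> t))) t 0"
    using k(1) has_coord_velocity_shift[of k "\<lambda>t. mul (\<alpha> t) (ginv (\<beta> t))" t 0] by blast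
qed

text \<open>The curve is an integral curve of the left-invariant field with value \<open>w\<close>
  at \<open>e\<close>, obtained from the differential equation in the coordinates of
  \<open>c\<close>.\<close>

lemma left_velocity_curve:
  fixes w :: 'd
  assumes c: "c \<in> A" "e \<in> chart_dom c"
  obtains \<delta> \<gamma> where "0 < \<delta>" "\<gamma> 0 = e"
    "\<And>t. \<bar>t\<bar> < \<delta> \<Longrightarrow> \<gamma> t \<in> chart_dom c \<and> isCont \<gamma> t \<and> left_velocity c \<gamma> t w"
    "\<And>k. Ck_on k {-\<delta><..<\<delta>} (chart_map c \<circ> \<gamma>)"
proof -
  note chart_c = is_chart[OF c(1)]
  define U where "U = chart_map c ` chart_dom c"
  define m where "m = chart_map c \<circ> (\<lambda>(a, b). mul a b) \<circ> chart_inv (prod_chart c c)"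
  define S where "S = chart_map (prod_chart c c) `
    (chart_dom (prod_chart c c) \<inter> (\<lambda>(a, b). mul a b) -` chart_dom c)"
  \<comment> \<open>The left-invariant field in coordinates: the derivative at \<open>e\<close> of
    left translation by the point with coordinates \<open>y\<close>, applied to
    \<open>w\<close>.\<close>
  define F where "F y = frechet_derivative m (at (y, chart_map c e)) (0, w)" for y
  have prod_c: "prod_chart c c \<in> prod_atlas A A"
    using c(1) unfolding prod_atlas_def by blast
  have "open U"
    using chart_c by (simp add: U_def is_chart_def)
  have "open S"
    unfolding S_def using smooth_mult open_dom[OF c(1)]
    by (intro open_chart_image is_chart_prod chart_c open_vimage) (auto simp: smooth_map_def)
  have m: "Ck_on k S m" for k
    using smooth_mult prod_c c(1) unfolding smooth_map_def smooth_on_def S_def m_def by blast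
  have "Ck_on k {y. (y, chart_map c e) \<in> S} F" for k
    using Ck_on_slice_left[OF \<open>open S\<close>, of k "\<lambda>p. frechet_derivative m (at p) (0, w)" "chart_map c e"]
      m[of "Suc k"] by (simp add: F_def[abs_def])
  \<comment> \<open>Since \<open>mul a e = a\<close>, the product stays in the chart for every
    \<open>a\<close> in it, so the field is smooth on all of \<open>U\<close>.\<close>
  moreover have "U \<subseteq> {y. (y, chart_map c e) \<in> S}"
    using c(2) by (force simp: U_def S_def)
  ultimately have F: "Ck_on k U F" for k
    using Ck_on_subset by blast
  have "chart_map c e \<in> U"
    using c(2) by (simp add: U_def)
  then obtain \<delta> y where \<delta>: "0 < \<delta>" "y 0 = chart_map c e"
    and y: "\<And>t. \<bar>t\<bar> < \<delta> \<Longrightarrow> y t \<in> U \<and> (y has_vector_derivative F (y t)) (at t)"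
    using ode_local_solution[OF finite_dim \<open>open U\<close> F] by metis
  define \<gamma> where "\<gamma> t = chart_inv c (y t)" for t
  have \<gamma>: "\<gamma> t \<in> chart_dom c" "chart_map c (\<gamma> t) = y t" if "\<bar>t\<bar> < \<delta>" for t
    using y[OF that] is_chart_inv[OF chart_c] by (auto simp: \<gamma>_def U_def)
  have vel: "has_coord_velocity c \<gamma> t (F (y t))" if t: "\<bar>t\<bar> < \<delta>" for t
  proof -
    have "isCont \<gamma> t"
      unfolding \<gamma>_def using y[OF t] isCont_chart_inv[OF chart_c, of "y t"]
        has_vector_derivative_continuous isCont_o2 unfolding U_def by blast
    moreover have "((chart_map c \<circ> \<gamma>) has_vector_derivative F (y t)) (at t)"
      by (rule has_vector_derivative_transform_within_open[of y _ _ "{-\<delta><..<\<delta>}"])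
        (use y[OF t] t \<gamma> in auto)
    ultimately show ?thesis
      using \<gamma>(1)[OF t] by (simp add: has_coord_velocity_def)
  qed
  have left: "left_velocity c \<gamma> t w" if t: "\<bar>t\<bar> < \<delta>" for t
  proof -
    \<comment> \<open>Take a curve through \<open>e\<close> with velocity \<open>w\<close>. Its left
      translate by \<open>\<gamma> t\<close> has velocity \<open>F (y t)\<close>, the same as
      \<open>\<gamma>\<close> at time \<open>t\<close>. Translating both back by
      \<open>ginv (\<gamma> t)\<close> gives equal velocities, and that of the first is
      \<open>w\<close>.\<close>
    obtain \<beta> where \<beta>: "\<beta> 0 = e" "has_coord_velocity c \<beta> 0 w"
      by (rule coord_line_velocity[OF chart_c c(2)])
    obtain c1 where c1: "c1 \<in> A" "ginv (\<gamma> t) \<in> chart_dom c1" by (rule chart_exists)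
    have F_eq: "F (y t) = chart_deriv (prod_chart c c) c (\<lambda>(a, b). mul a b) (\<gamma> t, e) (0, w)"
      by (simp add: F_def m_def \<gamma>(2)[OF t])
    have "has_coord_velocity c (\<lambda>h. mul (\<gamma> t) (\<beta> h)) 0 (F (y t))"
      using has_coord_velocity_map2[OF smooth_mult c(1,1,1) _ chart_c chart_c
          has_coord_velocity_const[OF \<gamma>(1)[OF t]] \<beta>(2)] \<beta>(1) \<gamma>(1)[OF t]
      by (simp add: F_eq)
    note left_mult = has_coord_velocity_map2[OF smooth_mult c1(1) c(1,1) _ is_chart[OF c1(1)] chart_c
        has_coord_velocity_const[OF c1(2)]]
    let ?D = "chart_deriv (prod_chart c1 c) c (\<lambda>(a, b). mul a b) (ginv (\<gamma> t), \<gamma> t)"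
    have "has_coord_velocity c \<beta> 0 (?D (0, F (y t)))"
      using left_mult[OF _ \<open>has_coord_velocity c (\<lambda>h. mul (\<gamma> t) (\<beta> h)) 0 (F (y t))\<close>] \<beta>(1) c(2)
      by simp
    then have "?D (0, F (y t)) = w"
      using \<beta>(2) by (rule has_coord_velocity_unique)
    moreover have "has_coord_velocity c (\<lambda>h. \<gamma> (t + h)) 0 (F (y t))"
      using vel[OF t] by (simp add: has_coord_velocity_shift)
    ultimately show ?thesis
      unfolding left_velocity_def
      using left_mult[where \<beta> = "\<lambda>h. \<gamma> (t + h)" and t = 0 and z = "F (y t)"] c(2) by simp
  qed
  show ?thesis
  proof (rule that[OF \<delta>(1), of \<gamma>])
    show "\<gamma> 0 = e"
      using is_chart_inv[OF chart_c c(2)] by (simp add: \<gamma>_def \<delta>(2))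
    show "\<gamma> t \<in> chart_dom c \<and> isCont \<gamma> t \<and> left_velocity c \<gamma> t w" if "\<bar>t\<bar> < \<delta>" for t
      using \<gamma>(1) vel left that by (simp add: has_coord_velocity_def)
    have "y ` {-\<delta><..<\<delta>} \<subseteq> U"
      using y by force
    then have "Ck_on k {-\<delta><..<\<delta>} y" for k
      using y by (intro Ck_on_ode_solution[OF finite_dim _ _ F]) auto
    then show "Ck_on k {-\<delta><..<\<delta>} (chart_map c \<circ> \<gamma>)" for k
      by (rule Ck_on_cong[rotated 2]) (auto simp: \<gamma>(2) abs_less_iff)
  qed
qed

text \<open>As functions of \<open>t\<close>, both sides have left logarithmic derivative
  \<open>w\<close>, which left translation by \<open>\<gamma> s\<close> does not change, and they
  agree at \<open>t = 0\<close>. Halving \<open>\<delta>\<close> keeps \<open>s + t\<close> in the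
  interval.\<close>

lemma left_velocity_local_hom:
  assumes c: "c \<in> A" "e \<in> chart_dom c" and "\<gamma> 0 = e"
    and vel: "\<And>t. \<bar>t\<bar> < \<delta> \<Longrightarrow> left_velocity c \<gamma> t w"
    and st: "\<bar>s\<bar> < \<delta> / 2" "\<bar>t\<bar> < \<delta> / 2"
  shows "\<gamma> (s + t) = mul (\<gamma> s) (\<gamma> t)"
proof -
  have "mul (mul (\<gamma> s) (\<gamma> t)) (ginv (\<gamma> (s + t))) = mul (mul (\<gamma> s) (\<gamma> 0)) (ginv (\<gamma> (s + 0)))"
  proof (rule left_velocity_unique[OF c])
    show "open {-(\<delta> / 2)<..<\<delta> / 2}" "connected {-(\<delta> / 2)<..<\<delta> / 2}"
      by simp_all
    show "left_velocity c (\<lambda>t. mul (\<gamma> s) (\<gamma> t)) t w" if "t \<in> {-(\<delta> / 2)<..<\<delta> / 2}" for t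
    proof -
      have "\<bar>t\<bar> < \<delta>"
        using that by auto
      then show ?thesis
        using vel[of t] by (simp add: left_velocity_def inverse_distrib_swap assoc)
    qed
    show "left_velocity c (\<lambda>t. \<gamma> (s + t)) t w" if "t \<in> {-(\<delta> / 2)<..<\<delta> / 2}" for t
    proof -
      have "\<bar>s + t\<bar> < \<delta>"
        using that st(1) by auto
      then show ?thesis
        using vel[of "s + t"] by (simp add: left_velocity_def add.assoc)
    qed
  qed (use st in auto)
  then have "mul (mul (mul (\<gamma> s) (\<gamma> t)) (ginv (\<gamma> (s + t)))) (\<gamma> (s + t)) = \<gamma> (s + t)"
    using \<open>\<gamma> 0 = e\<close> by simp
  then show ?thesis
    by (simp add: assoc)
qed

text \<open>The value \<open>\<Gamma> t\<close> is \<open>\<gamma> (t / 2 ^ n)\<close> squared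
  \<open>n\<close> times, with \<open>n\<close> so large that \<open>\<gamma>\<close> is used only
  within \<open>\<epsilon>\<close> of \<open>0\<close>. By \<open>hom\<close> for two equal halves,
  one more halving and squaring changes nothing, so \<open>n\<close> does not matter.\<close>

lemma local_hom_extends:
  fixes \<gamma> :: "real \<Rightarrow> 'g"
  assumes "0 < \<epsilon>" and hom: "\<And>s t. \<bar>s\<bar> < \<epsilon> \<Longrightarrow> \<bar>t\<bar> < \<epsilon> \<Longrightarrow> \<gamma> (s + t) = mul (\<gamma> s) (\<gamma> t)"
  obtains \<Gamma> where "\<And>s t. \<Gamma> (s + t) = mul (\<Gamma> s) (\<Gamma> t)" "\<And>t. \<bar>t\<bar> < \<epsilon> \<Longrightarrow> \<Gamma> t = \<gamma> t"
proof -
  define sq where "sq x = mul x x" for x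
  have sq_mul1: "sq (mul x y) = mul (sq x) (sq y) \<and> mul (sq x) (sq y) = mul (sq y) (sq x)"
    if "mul x y = mul y x" for x y
  proof -
    have "mul x (mul y z) = mul y (mul x z)" for z
      using that by (metis assoc)
    with that show ?thesis
      by (simp add: sq_def assoc)
  qed
  \<comment> \<open>Squaring is multiplicative only on commuting elements, so the induction carries
    along that the powers commute.\<close>
  have sq_mul: "(sq ^^ n) (mul x y) = mul ((sq ^^ n) x) ((sq ^^ n) y) \<and>
      mul ((sq ^^ n) x) ((sq ^^ n) y) = mul ((sq ^^ n) y) ((sq ^^ n) x)"
    if "mul x y = mul y x" for n x y
  proof (induction n)
    case 0
    then show ?case using that by simp
  next
    case (Suc n)
    then show ?case
      using sq_mul1[of "(sq ^^ n) x" "(sq ^^ n) y"] by simp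
  qed
  define G where "G n t = (sq ^^ n) (\<gamma> (t / 2 ^ n))" for n t
  define P where "P n t \<longleftrightarrow> \<bar>t\<bar> < \<epsilon> * 2 ^ n" for n and t :: real
  have P_mono: "P n t \<Longrightarrow> n \<le> m \<Longrightarrow> P m t" for n m t
    using \<open>0 < \<epsilon>\<close> unfolding P_def
    by (meson less_le_trans mult_left_mono less_imp_le one_le_numeral power_increasing)
  have small: "\<bar>t / 2 ^ n\<bar> < \<epsilon>" if "P n t" for n t
    using that by (simp add: P_def pos_divide_less_eq abs_divide)
  have G_Suc: "G (Suc n) t = G n t" if "P n t" for n t
  proof -
    have *: "\<bar>t / 2 ^ Suc n\<bar> < \<epsilon>"
      by (intro small P_mono[OF that]) simp
    have "t / 2 ^ n = t / 2 ^ Suc n + t / 2 ^ Suc n"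
      by simp
    then have "\<gamma> (t / 2 ^ n) = sq (\<gamma> (t / 2 ^ Suc n))"
      using hom[OF * *] by (simp only: sq_def)
    then show ?thesis
      by (simp only: G_def funpow_Suc_right comp_apply)
  qed
  have G_eq: "G m t = G n t" if "P n t" "n \<le> m" for n m t
    using that(2)
  proof (induction m rule: dec_induct)
    case (step k)
    then show ?case
      using G_Suc[OF P_mono[OF that(1)], of k] by simp
  qed simp
  have P_ex: "\<exists>n. P n t" for t
  proof -
    obtain n where "\<bar>t\<bar> / \<epsilon> < 2 ^ n"
      using real_arch_pow[of 2] by auto
    then show ?thesis
      using \<open>0 < \<epsilon>\<close> by (auto simp: P_def pos_divide_less_eq mult.commute)
  qed
  define \<Gamma> where "\<Gamma> t = G (LEAST n. P n t) t" for t
  have \<Gamma>: "\<Gamma> t = G n t" if "P n t" for n t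
    unfolding \<Gamma>_def using that by (intro G_eq[symmetric] LeastI[of "\<lambda>n. P n t"] Least_le)
  show ?thesis
  proof (rule that)
    show "\<Gamma> t = \<gamma> t" if "\<bar>t\<bar> < \<epsilon>" for t
      using \<Gamma>[of 0 t] that by (simp add: P_def G_def)
    show "\<Gamma> (s + t) = mul (\<Gamma> s) (\<Gamma> t)" for s t
    proof -
      \<comment> \<open>A single \<open>n\<close> that serves \<open>s\<close>, \<open>t\<close> and
        \<open>s + t\<close> at once.\<close>
      obtain n where "P n (\<bar>s\<bar> + \<bar>t\<bar>)"
        using P_ex by blast
      then have P: "P n s" "P n t" "P n (s + t)"
        by (auto simp: P_def)
      \<comment> \<open>Addition of reals is commutative, so \<open>hom\<close> read in both orders
        makes values of \<open>\<gamma>\<close> near \<open>0\<close> commute.\<close>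
      have "mul (\<gamma> (s / 2 ^ n)) (\<gamma> (t / 2 ^ n)) = mul (\<gamma> (t / 2 ^ n)) (\<gamma> (s / 2 ^ n))"
        using hom[OF small[OF P(1)] small[OF P(2)]] hom[OF small[OF P(2)] small[OF P(1)]]
        by (simp add: add.commute)
      moreover have "\<gamma> ((s + t) / 2 ^ n) = mul (\<gamma> (s / 2 ^ n)) (\<gamma> (t / 2 ^ n))"
        using hom[OF small[OF P(1)] small[OF P(2)]] by (simp add: add_divide_distrib)
      ultimately show ?thesis
        using sq_mul by (simp add: \<Gamma>[OF P(1)] \<Gamma>[OF P(2)] \<Gamma>[OF P(3)] G_def)
    qed
  qed
qed

section \<open>Smoothness, uniqueness and existence of one-parameter subgroups, and the exponential
  map\<close>

lemma chart_inv_id: "chart_inv (UNIV, \<lambda>x. x) = (\<lambda>x. x)"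
  by (rule ext) (simp add: chart_inv_def inv_f_f inj_on_def)

lemma smooth_curve_iff:
  "smooth_map model_atlas A \<gamma> \<longleftrightarrow> continuous_on UNIV \<gamma> \<and>
    (\<forall>d\<in>A. \<forall>k. Ck_on k (\<gamma> -` chart_dom d) (chart_map d \<circ> \<gamma>))"
  by (simp add: smooth_map_def model_atlas_def smooth_on_def chart_inv_id o_def)

lemma smooth_curve_velocity:
  assumes "smooth_map model_atlas A \<gamma>" "d \<in> A" "\<gamma> t \<in> chart_dom d"
  shows "has_coord_velocity d \<gamma> t (velocity A \<gamma> t d)"
proof -
  have "Ck_on (Suc 0) (\<gamma> -` chart_dom d) (chart_map d \<circ> \<gamma>)"
    using assms smooth_curve_iff by blast
  then have "(chart_map d \<circ> \<gamma>) differentiable (at t)"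
    using assms(3) by simp
  then show ?thesis
    using assms
    by (simp add: has_coord_velocity_def velocity_def charts_at_def vector_derivative_works
        smooth_map_def continuous_on_eq_continuous_at)
qed

lemma one_parameter_subgroup_zero:
  assumes "one_parameter_subgroup A mul \<gamma>"
  shows "\<gamma> 0 = e"
proof -
  have "mul (\<gamma> 0) (\<gamma> 0) = mul (\<gamma> 0) e"
    using assms unfolding one_parameter_subgroup_def by (metis add_0 right_neutral)
  then show ?thesis
    by (simp only: left_cancel)
qed

text \<open>By the homomorphism law \<open>ginv (\<gamma> t)\<close> times
  \<open>\<gamma> (t + h)\<close> is \<open>\<gamma> h\<close>, so the left logarithmic derivative
  is constant in time.\<close>

lemma one_parameter_subgroup_left_velocity:
  assumes \<gamma>: "one_parameter_subgroup A mul \<gamma>" and c: "c \<in> A" "e \<in> chart_dom c"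
  shows "left_velocity c \<gamma> t (velocity A \<gamma> 0 c)"
proof -
  have "has_coord_velocity c \<gamma> 0 (velocity A \<gamma> 0 c)"
    using \<gamma> c one_parameter_subgroup_zero[OF \<gamma>]
    by (intro smooth_curve_velocity) (simp_all add: one_parameter_subgroup_def)
  then show ?thesis
    using \<gamma> by (simp add: left_velocity_def one_parameter_subgroup_def)
qed

text \<open>Both curves have the same constant left logarithmic derivative and start at
  \<open>e\<close>, so their quotient stays \<open>e\<close>. This determines the subgroup selected
  by \<open>THE\<close> in \<open>lie_exp\<close>.\<close>

lemma one_parameter_subgroup_unique:
  assumes "one_parameter_subgroup A mul \<alpha>" "one_parameter_subgroup A mul \<beta>"
    and "velocity A \<alpha> 0 = velocity A \<beta> 0"
  shows "\<alpha> = \<beta>"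
proof
  fix t
  obtain c where c: "c \<in> A" "e \<in> chart_dom c" by (rule chart_exists)
  have "mul (\<alpha> t) (ginv (\<beta> t)) = mul (\<alpha> 0) (ginv (\<beta> 0))"
  proof (rule left_velocity_unique[OF c, where I = UNIV])
    show "left_velocity c \<alpha> t (velocity A \<alpha> 0 c)" "left_velocity c \<beta> t (velocity A \<alpha> 0 c)" for t
      using one_parameter_subgroup_left_velocity c assms by metis+
  qed simp_all
  then have "mul (mul (\<alpha> t) (ginv (\<beta> t))) (\<beta> t) = \<beta> t"
    using assms by (simp add: one_parameter_subgroup_zero)
  then show "\<alpha> t = \<beta> t"
    by (simp add: assoc)
qed

lemma Ck_on_affine: "Ck_on k S (\<lambda>t::real. r * t + s)"
proof -
  have "Ck_on k UNIV (\<lambda>t::real. r * t + s)"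
  proof (cases k)
    case 0
    then show ?thesis by (simp add: continuous_intros)
  next
    case (Suc j)
    show ?thesis
      unfolding Suc
      by (rule Ck_on_SucI[OF open_UNIV, where f' = "\<lambda>_ v. r * v"])
        (auto intro!: derivative_eq_intros Ck_on_const)
  qed
  then show ?thesis
    by (rule Ck_on_subset) simp
qed

lemma Ck_on_compose_affine:
  assumes "open S" "Ck_on k T f" "\<And>t. t \<in> S \<Longrightarrow> r * t + s \<in> T"
  shows "Ck_on k S (\<lambda>t::real. f (r * t + s))"
proof (rule Ck_on_compose[OF _ \<open>open S\<close> _ Ck_on_affine \<open>Ck_on k T f\<close>])
  show "\<exists>B::real set. finite B \<and> span B = UNIV"
    by (intro exI[of _ "{1}"]) (auto simp: span_singleton)
qed (use assms in auto)

text \<open>Writing \<open>\<Gamma> t\<close> as \<open>\<Gamma> s\<close> times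
  \<open>\<Gamma> (t - s)\<close> makes the curve near \<open>s\<close> a left translate of the
  curve near \<open>0\<close>; in coordinates left translation is a slice of the smooth
  multiplication.\<close>

lemma hom_smooth_curve:
  fixes \<Gamma> :: "real \<Rightarrow> 'g"
  assumes c: "c \<in> A" "e \<in> chart_dom c" and "0 < \<epsilon>"
    and hom: "\<And>s t. \<Gamma> (s + t) = mul (\<Gamma> s) (\<Gamma> t)" and "isCont \<Gamma> 0"
    and dom: "\<And>t. \<bar>t\<bar> < \<epsilon> \<Longrightarrow> \<Gamma> t \<in> chart_dom c"
    and smooth: "\<And>k. Ck_on k {-\<epsilon><..<\<epsilon>} (chart_map c \<circ> \<Gamma>)"
  shows "smooth_map model_atlas A \<Gamma>"
proof -
  have shift: "\<Gamma> t = mul (\<Gamma> s) (\<Gamma> (t - s))" for s t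
    using hom[of s "t - s"] by simp
  have cont: "isCont \<Gamma> s" for s
  proof -
    have "isCont (\<lambda>t. t - s) s"
      by (intro continuous_intros)
    then have "isCont (\<lambda>t. \<Gamma> (t - s)) s"
      using \<open>isCont \<Gamma> 0\<close> isCont_o2[of s "\<lambda>t. t - s" \<Gamma>] by simp
    then have "((\<lambda>t. \<Gamma> (t - s)) \<longlongrightarrow> \<Gamma> 0) (at s)"
      by (simp add: isCont_def)
    then have "((\<lambda>t. (\<Gamma> s, \<Gamma> (t - s))) \<longlongrightarrow> (\<Gamma> s, \<Gamma> 0)) (at s)"
      by (intro tendsto_Pair tendsto_const)
    then have "((\<lambda>t. case (\<Gamma> s, \<Gamma> (t - s)) of (a, b) \<Rightarrow> mul a b) \<longlongrightarrow>
        (case (\<Gamma> s, \<Gamma> 0) of (a, b) \<Rightarrow> mul a b)) (at s)"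
      using smooth_mult unfolding smooth_map_def
      by (intro continuous_on_tendsto_compose[of UNIV "\<lambda>(a, b). mul a b"]) simp_all
    moreover have "(\<lambda>t. case (\<Gamma> s, \<Gamma> (t - s)) of (a, b) \<Rightarrow> mul a b) = \<Gamma>"
      using shift[symmetric] by simp
    moreover have "(case (\<Gamma> s, \<Gamma> 0) of (a, b) \<Rightarrow> mul a b) = \<Gamma> s"
      using shift[of s s, symmetric] by simp
    ultimately show ?thesis
      by (simp only: isCont_def)
  qed
  then have cont_on: "continuous_on UNIV \<Gamma>"
    by (simp add: continuous_on_eq_continuous_at)
  have "Ck_on k (\<Gamma> -` chart_dom d) (chart_map d \<circ> \<Gamma>)" if d: "d \<in> A" for d k
  proof (rule Ck_on_local)
    fix s assume s: "s \<in> \<Gamma> -` chart_dom d"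
    obtain c1 where c1: "c1 \<in> A" "\<Gamma> s \<in> chart_dom c1" by (rule chart_exists)
    let ?p = "prod_chart c1 c"
    define h where "h = chart_map d \<circ> (\<lambda>(a, b). mul a b) \<circ> chart_inv ?p"
    define S where "S = chart_map ?p ` (chart_dom ?p \<inter> (\<lambda>(a, b). mul a b) -` chart_dom d)"
    have charts: "is_chart ?p"
      by (intro is_chart_prod is_chart c c1)
    have "open S"
      unfolding S_def using smooth_mult open_dom[OF d]
      by (intro open_chart_image charts open_vimage) (auto simp: smooth_map_def)
    have "?p \<in> prod_atlas A A"
      using c(1) c1(1) unfolding prod_atlas_def by blast
    then have "Ck_on k S h"
      using smooth_mult d unfolding smooth_map_def smooth_on_def S_def h_def by blast
    then have h: "Ck_on k {z. (chart_map c1 (\<Gamma> s), z) \<in> S} (\<lambda>z. h (chart_map c1 (\<Gamma> s), z))"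
      by (rule Ck_on_slice_right[OF \<open>open S\<close>])
    \<comment> \<open>For \<open>t\<close> in this set the time \<open>t - s\<close> lies in the
      interval where smoothness is given, and \<open>\<Gamma> t\<close> lies in the domain of
      \<open>d\<close>.\<close>
    let ?T = "{s - \<epsilon><..<s + \<epsilon>} \<inter> \<Gamma> -` chart_dom d"
    have "open ?T"
      using open_dom[OF d] cont_on by (intro open_Int open_vimage) auto
    have T: "\<Gamma> (t - s) \<in> chart_dom c" "mul (\<Gamma> s) (\<Gamma> (t - s)) \<in> chart_dom d" if "t \<in> ?T" for t
      using that dom[of "t - s"] shift[of t s] by auto
    have "Ck_on k ?T (\<lambda>t. (chart_map c \<circ> \<Gamma>) (1 * t + - s))"
      by (rule Ck_on_compose_affine[OF \<open>open ?T\<close> smooth]) auto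
    then have "Ck_on k ?T (\<lambda>t. chart_map c (\<Gamma> (t - s)))"
      by simp
    from Ck_on_compose[OF finite_dim \<open>open ?T\<close> _ this h]
    have "Ck_on k ?T (\<lambda>t. h (chart_map c1 (\<Gamma> s), chart_map c (\<Gamma> (t - s))))"
      using T c1(2) by (force simp: S_def)
    then have "Ck_on k ?T (chart_map d \<circ> \<Gamma>)"
    proof (rule Ck_on_cong[OF \<open>open ?T\<close>, rotated])
      fix t assume "t \<in> ?T"
      then have "chart_inv ?p (chart_map ?p (\<Gamma> s, \<Gamma> (t - s))) = (\<Gamma> s, \<Gamma> (t - s))"
        using c1(2) T by (intro is_chart_inv[OF charts]) simp
      then show "h (chart_map c1 (\<Gamma> s), chart_map c (\<Gamma> (t - s))) = (chart_map d \<circ> \<Gamma>) t"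
        using shift[of t s] by (simp add: h_def)
    qed
    then show "\<exists>T. open T \<and> s \<in> T \<and> Ck_on k T (chart_map d \<circ> \<Gamma>)"
      using \<open>open ?T\<close> s \<open>0 < \<epsilon>\<close> by (intro exI[of _ ?T]) auto
  qed
  with cont_on show ?thesis
    by (simp add: smooth_curve_iff)
qed

text \<open>The local curve with left velocity \<open>v c\<close> is a homomorphism near
  \<open>0\<close> and extends to all times. The extension agrees with it near \<open>0\<close>,
  which gives its velocity there, and the homomorphism law spreads smoothness from \<open>0\<close>
  to every time.\<close>

lemma one_parameter_subgroup_exists:
  assumes v: "v \<in> lie_algebra A e"
  obtains \<Gamma> where "one_parameter_subgroup A mul \<Gamma>" "velocity A \<Gamma> 0 = v"
proof -
  obtain c where c: "c \<in> A" "e \<in> chart_dom c" by (rule chart_exists)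
  obtain \<delta> \<gamma> where \<delta>: "0 < \<delta>" "\<gamma> 0 = e"
    and \<gamma>: "\<And>t. \<bar>t\<bar> < \<delta> \<Longrightarrow> \<gamma> t \<in> chart_dom c \<and> isCont \<gamma> t \<and> left_velocity c \<gamma> t (v c)"
    and smooth: "\<And>k. Ck_on k {-\<delta><..<\<delta>} (chart_map c \<circ> \<gamma>)"
    using left_velocity_curve[OF c] by metis
  \<comment> \<open>The homomorphism law of the local curve is available on half of its
    interval.\<close>
  define \<epsilon> where "\<epsilon> = \<delta> / 2"
  have "0 < \<epsilon>" "\<epsilon> < \<delta>"
    using \<delta>(1) by (simp_all add: \<epsilon>_def)
  have "\<gamma> (s + t) = mul (\<gamma> s) (\<gamma> t)" if "\<bar>s\<bar> < \<epsilon>" "\<bar>t\<bar> < \<epsilon>" for s t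
    using \<gamma> that unfolding \<epsilon>_def by (intro left_velocity_local_hom[OF c, where \<delta> = \<delta>] \<delta>(2)) auto
  then obtain \<Gamma> where hom: "\<And>s t. \<Gamma> (s + t) = mul (\<Gamma> s) (\<Gamma> t)"
    and eq: "\<And>t. \<bar>t\<bar> < \<epsilon> \<Longrightarrow> \<Gamma> t = \<gamma> t"
    using local_hom_extends[OF \<open>0 < \<epsilon>\<close>] by metis
  have vel: "has_coord_velocity c \<Gamma> 0 (v c)"
  proof (rule has_coord_velocity_transform)
    show "has_coord_velocity c \<gamma> 0 (v c)"
      using \<gamma>[of 0] \<delta> inverse_neutral by (simp add: left_velocity_def)
    show "\<gamma> s = \<Gamma> s" if "s \<in> {-\<epsilon><..<\<epsilon>}" for s
      using eq[of s] that by auto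
  qed (use \<open>0 < \<epsilon>\<close> in auto)
  have "Ck_on k {-\<epsilon><..<\<epsilon>} (chart_map c \<circ> \<Gamma>)" for k
  proof (rule Ck_on_cong)
    show "Ck_on k {-\<epsilon><..<\<epsilon>} (chart_map c \<circ> \<gamma>)"
      using \<open>\<epsilon> < \<delta>\<close> by (intro Ck_on_subset[OF smooth]) auto
    show "(chart_map c \<circ> \<gamma>) t = (chart_map c \<circ> \<Gamma>) t" if "t \<in> {-\<epsilon><..<\<epsilon>}" for t
      using eq[of t] that by auto
  qed simp
  then have "smooth_map model_atlas A \<Gamma>"
    using vel \<gamma> eq \<open>0 < \<epsilon>\<close> \<open>\<epsilon> < \<delta>\<close>
    by (intro hom_smooth_curve[OF c \<open>0 < \<epsilon>\<close> hom]) (auto simp: has_coord_velocity_def)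
  then have "one_parameter_subgroup A mul \<Gamma>"
    using hom by (simp add: one_parameter_subgroup_def)
  moreover have "velocity A \<Gamma> 0 = v"
  proof
    fix d
    have "\<Gamma> 0 = e"
      using eq[of 0] \<open>0 < \<epsilon>\<close> \<delta>(2) by simp
    show "velocity A \<Gamma> 0 d = v d"
    proof (cases "d \<in> charts_at A e")
      case True
      then have d: "d \<in> A" "\<Gamma> 0 \<in> chart_dom d"
        by (auto simp: charts_at_def \<open>\<Gamma> 0 = e\<close>)
      \<comment> \<open>The entry of a tangent vector in \<open>c\<close> determines its entries in
        the other charts, by the rule by which velocities change charts.\<close>
      have "v d = frechet_derivative (chart_map d \<circ> chart_inv c) (at (chart_map c e)) (v c)"
        using v True c unfolding lie_algebra_def tangent_space_def charts_at_def by blast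
      then have "v d = chart_deriv c d (\<lambda>x. x) (\<Gamma> 0) (v c)"
        by (simp add: o_def \<open>\<Gamma> 0 = e\<close>)
      then have "has_coord_velocity d \<Gamma> 0 (v d)"
        using has_coord_velocity_map[OF smooth_map_ident c(1) d is_chart[OF c(1)] vel] by simp
      then show ?thesis
        using True by (simp add: has_coord_velocity_def velocity_def \<open>\<Gamma> 0 = e\<close> vector_derivative_at)
    next
      case False
      then have "v d = 0"
        using v unfolding lie_algebra_def tangent_space_def by blast
      with False show ?thesis
        by (simp add: velocity_def \<open>\<Gamma> 0 = e\<close>)
    qed
  qed
  ultimately show ?thesis
    by (rule that)
qed

lemma one_parameter_subgroup_scale:
  assumes \<gamma>: "one_parameter_subgroup A mul \<gamma>"
  shows "one_parameter_subgroup A mul (\<lambda>s. \<gamma> (r * s))"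
    and "velocity A (\<lambda>s. \<gamma> (r * s)) 0 = r *\<^sub>R velocity A \<gamma> 0"
proof -
  have smooth: "smooth_map model_atlas A \<gamma>"
    using \<gamma> by (simp add: one_parameter_subgroup_def)
  have cont: "continuous_on UNIV (\<lambda>s. \<gamma> (r * s))"
    using smooth continuous_on_compose2[of UNIV \<gamma> UNIV "\<lambda>s. r * s"]
    by (simp add: smooth_map_def continuous_on_mult_left)
  have "Ck_on k ((\<lambda>s. \<gamma> (r * s)) -` chart_dom d) (chart_map d \<circ> (\<lambda>s. \<gamma> (r * s)))"
    if d: "d \<in> A" for d k
  proof -
    have "open ((\<lambda>s. \<gamma> (r * s)) -` chart_dom d)"
      using open_dom[OF d] cont by (rule open_vimage)
    moreover have "Ck_on k (\<gamma> -` chart_dom d) (chart_map d \<circ> \<gamma>)"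
      using smooth d smooth_curve_iff by blast
    ultimately have "Ck_on k ((\<lambda>s. \<gamma> (r * s)) -` chart_dom d) (\<lambda>s. (chart_map d \<circ> \<gamma>) (r * s + 0))"
      by (rule Ck_on_compose_affine) simp
    then show ?thesis
      by (simp add: o_def)
  qed
  with cont show "one_parameter_subgroup A mul (\<lambda>s. \<gamma> (r * s))"
    using \<gamma> by (simp add: one_parameter_subgroup_def smooth_curve_iff distrib_left)
  show "velocity A (\<lambda>s. \<gamma> (r * s)) 0 = r *\<^sub>R velocity A \<gamma> 0"
  proof
    fix d
    show "velocity A (\<lambda>s. \<gamma> (r * s)) 0 d = (r *\<^sub>R velocity A \<gamma> 0) d"
    proof (cases "d \<in> charts_at A (\<gamma> 0)")
      case True
      then have "has_coord_velocity d \<gamma> (r * 0 + 0) (velocity A \<gamma> 0 d)"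
        using smooth_curve_velocity[OF smooth] by (simp add: charts_at_def)
      from has_coord_velocity_affine[OF this] True show ?thesis
        by (simp add: has_coord_velocity_def scaleR_fun_def vector_derivative_at velocity_def)
    next
      case False
      then show ?thesis
        by (simp add: velocity_def scaleR_fun_def)
    qed
  qed
qed

text \<open>The one-parameter subgroup with initial velocity \<open>t *\<^sub>R v\<close> is
  \<open>\<lambda>s. \<Gamma> (t * s)\<close>, and \<open>lie_exp\<close> evaluates it at
  \<open>1\<close>.\<close>

lemma lie_exp_eq:
  assumes "one_parameter_subgroup A mul \<Gamma>" "velocity A \<Gamma> 0 = v"
  shows "lie_exp A mul (t *\<^sub>R v) = \<Gamma> t"
proof -
  have "(THE \<gamma>. one_parameter_subgroup A mul \<gamma> \<and> velocity A \<gamma> 0 = t *\<^sub>R v) = (\<lambda>s. \<Gamma> (t * s))"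
    using one_parameter_subgroup_scale[OF assms(1), of t] assms(2)
    by (intro the_equality) (auto intro: one_parameter_subgroup_unique)
  then show ?thesis
    by (simp add: lie_exp_def)
qed

end

section \<open>Flows of fundamental fields\<close>

context homogeneous_space
begin

text \<open>The field is defined through \<open>vector_derivative\<close>, which is meaningful once
  the orbit curve is known to be differentiable. Smoothness of the action supplies this, with
  \<open>\<Gamma> h\<close> in place of the exponential.\<close>

lemma fundamental_field_velocity:
  assumes \<Gamma>: "one_parameter_subgroup A mul \<Gamma>" "velocity A \<Gamma> 0 = v"
    and d: "d \<in> B" "x \<in> chart_dom d"
  shows "has_coord_velocity d (\<lambda>h. act (\<Gamma> h) x) 0 (fundamental_field A mul B act v x d)"
proof -
  have \<Gamma>0: "\<Gamma> 0 = e"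
    by (rule G.one_parameter_subgroup_zero[OF \<Gamma>(1)])
  obtain c where c: "c \<in> A" "e \<in> chart_dom c" by (rule G.chart_exists)
  have "has_coord_velocity c \<Gamma> 0 (velocity A \<Gamma> 0 c)"
    using \<Gamma>(1) c by (intro G.smooth_curve_velocity) (simp_all add: one_parameter_subgroup_def \<Gamma>0)
  from has_coord_velocity_map2[OF smooth_act c(1) d(1,1) _ G.is_chart[OF c(1)] M.is_chart[OF d(1)] this
      has_coord_velocity_const[OF d(2)]]
  obtain w where w: "has_coord_velocity d (\<lambda>h. act (\<Gamma> h) x) 0 w"
    using d(2) by (auto simp: \<Gamma>0 act_one)
  moreover have "fundamental_field A mul B act v x d = w"
    using w d unfolding has_coord_velocity_def
    by (simp add: fundamental_field_def velocity_def charts_at_def G.lie_exp_eq[OF \<Gamma>] \<Gamma>0 act_one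
        vector_derivative_at)
  ultimately show ?thesis by simp
qed

text \<open>Since \<open>\<Gamma> (t + h)\<close> is also \<open>\<Gamma> h\<close> times
  \<open>\<Gamma> t\<close>, the orbit of \<open>x\<close> restarts at time \<open>t\<close> as the
  orbit of \<open>act (\<Gamma> t) x\<close>; its velocity there is the fundamental field at that
  point.\<close>

lemma act_integral_curve:
  assumes \<Gamma>: "one_parameter_subgroup A mul \<Gamma>" "velocity A \<Gamma> 0 = v"
  shows "integral_curve B (fundamental_field A mul B act v) I (\<lambda>t. act (\<Gamma> t) x)"
proof -
  have hom: "act (\<Gamma> (t + h)) x = act (\<Gamma> h) (act (\<Gamma> t) x)" for t h
    using \<Gamma>(1) unfolding one_parameter_subgroup_def by (metis act_mult add.commute)
  have vel: "has_coord_velocity d (\<lambda>t. act (\<Gamma> t) x) t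
      (fundamental_field A mul B act v (act (\<Gamma> t) x) d)"
    if "d \<in> charts_at B (act (\<Gamma> t) x)" for t d
    using fundamental_field_velocity[OF \<Gamma>, of d "act (\<Gamma> t) x"] that
    by (simp add: charts_at_def flip: hom has_coord_velocity_shift[of d "\<lambda>t. act (\<Gamma> t) x" t])
  have "isCont (\<lambda>t. act (\<Gamma> t) x) t" for t
    using M.chart_exists[of "act (\<Gamma> t) x"] vel
    by (metis (mono_tags, lifting) charts_at_def has_coord_velocity_def mem_Collect_eq)
  then have "continuous_on I (\<lambda>t. act (\<Gamma> t) x)"
    by (simp add: continuous_at_imp_continuous_on)
  with vel show ?thesis
    by (simp add: integral_curve_def has_coord_velocity_def)
qed

text \<open>At time \<open>t + h\<close> the curve \<open>\<Gamma> (- t).\<gamma> t\<close> is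
  \<open>\<Gamma> (- t)\<close> applied to \<open>act (\<Gamma> (- h)) (\<gamma> (t + h))\<close>.
  In this inner curve the motion of the group element and that of \<open>\<gamma>\<close> contribute
  opposite velocities, so it is stationary at \<open>h = 0\<close>.\<close>

lemma integral_curve_unique:
  assumes \<Gamma>: "one_parameter_subgroup A mul \<Gamma>" "velocity A \<Gamma> 0 = v"
    and \<gamma>: "integral_curve B (fundamental_field A mul B act v) {a<..<b} \<gamma>"
    and "0 \<in> {a<..<b}" "t \<in> {a<..<b}"
  shows "\<gamma> t = act (\<Gamma> t) (\<gamma> 0)"
proof -
  let ?Y = "fundamental_field A mul B act v"
  have hom: "\<Gamma> (s + t) = mul (\<Gamma> s) (\<Gamma> t)" for s t
    using \<Gamma>(1) by (simp add: one_parameter_subgroup_def)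
  have \<Gamma>0: "\<Gamma> 0 = e"
    by (rule G.one_parameter_subgroup_zero[OF \<Gamma>(1)])
  have "act (\<Gamma> (- t)) (\<gamma> t) = act (\<Gamma> (- 0)) (\<gamma> 0)"
  proof (rule M.zero_velocity_imp_constant[OF _ _ \<open>t \<in> {a<..<b}\<close> \<open>0 \<in> {a<..<b}\<close>])
    fix t assume t: "t \<in> {a<..<b}"
    obtain c where c: "c \<in> A" "e \<in> chart_dom c" by (rule G.chart_exists)
    obtain c1 where c1: "c1 \<in> A" "\<Gamma> (- t) \<in> chart_dom c1" by (rule G.chart_exists)
    obtain d where d: "d \<in> B" "\<gamma> t \<in> chart_dom d" by (rule M.chart_exists)
    obtain k where k: "k \<in> B" "act (\<Gamma> (- t)) (\<gamma> t) \<in> chart_dom k" by (rule M.chart_exists)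
    have "isCont \<gamma> t"
      using \<gamma> t by (auto simp: integral_curve_def continuous_on_eq_continuous_at)
    then have "has_coord_velocity d \<gamma> t (?Y (\<gamma> t) d)"
      using \<gamma> t d unfolding integral_curve_def charts_at_def has_coord_velocity_def by blast
    then have vel_\<gamma>: "has_coord_velocity d (\<lambda>h. \<gamma> (t + h)) 0 (?Y (\<gamma> t) d)"
      by (simp add: has_coord_velocity_shift)
    have vel_\<Gamma>: "has_coord_velocity c \<Gamma> 0 (velocity A \<Gamma> 0 c)"
      using \<Gamma>(1) c by (intro G.smooth_curve_velocity) (simp_all add: one_parameter_subgroup_def \<Gamma>0)
    then have vel_neg: "has_coord_velocity c (\<lambda>h. \<Gamma> (- h)) 0 (- velocity A \<Gamma> 0 c)"
      using has_coord_velocity_affine[of c \<Gamma> "-1" 0 0] by simp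
    let ?D = "chart_deriv (prod_chart c d) d (\<lambda>(a, x). act a x) (e, \<gamma> t)"
    note inner = has_coord_velocity_map2[OF smooth_act c(1) d(1,1) _ G.is_chart[OF c(1)]
        M.is_chart[OF d(1)]]
    \<comment> \<open>The partial derivatives of the action at \<open>(e, \<gamma> t)\<close> are
      read off from known curves: moving the group element alone gives the fundamental field, and
      moving the point alone reproduces its velocity because \<open>e\<close> acts
      trivially.\<close>
    have "has_coord_velocity d (\<lambda>h. act (\<Gamma> h) (\<gamma> t)) 0 (?D (velocity A \<Gamma> 0 c, 0))"
      using inner[OF _ vel_\<Gamma> has_coord_velocity_const[OF d(2)]] d(2) by (simp add: \<Gamma>0 act_one)
    then have D1: "?D (velocity A \<Gamma> 0 c, 0) = ?Y (\<gamma> t) d"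
      by (rule has_coord_velocity_unique) (rule fundamental_field_velocity[OF \<Gamma> d])
    have "has_coord_velocity d (\<lambda>h. \<gamma> (t + h)) 0 (?D (0, ?Y (\<gamma> t) d))"
      using inner[OF _ has_coord_velocity_const[OF c(2)] vel_\<gamma>] d(2) by (simp add: act_one)
    then have D2: "?D (0, ?Y (\<gamma> t) d) = ?Y (\<gamma> t) d"
      by (rule has_coord_velocity_unique) (rule vel_\<gamma>)
    have "linear ?D"
      using c d by (intro linear_chart_deriv2[OF smooth_act]) (auto simp: act_one)
    then have "?D (- velocity A \<Gamma> 0 c, ?Y (\<gamma> t) d) = 0"
      using linear_diff[of ?D "(0, ?Y (\<gamma> t) d)" "(velocity A \<Gamma> 0 c, 0)"] D1 D2 by simp
    then have "has_coord_velocity d (\<lambda>h. act (\<Gamma> (- h)) (\<gamma> (t + h))) 0 0"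
      using inner[OF _ vel_neg vel_\<gamma>] d(2) by (simp add: \<Gamma>0 act_one)
    moreover have "chart_deriv (prod_chart c1 d) k (\<lambda>(a, x). act a x) (\<Gamma> (- t), \<gamma> t) (0, 0) = 0"
      using c1 d k by (intro linear_0_Pair linear_chart_deriv2[OF smooth_act]) auto
    ultimately have "has_coord_velocity k (\<lambda>h. act (\<Gamma> (- t)) (act (\<Gamma> (- h)) (\<gamma> (t + h)))) 0 0"
      using has_coord_velocity_map2[OF smooth_act c1(1) d(1) k(1) _ G.is_chart[OF c1(1)]
          M.is_chart[OF d(1)] has_coord_velocity_const[OF c1(2)], where t = 0 and z = 0
          and \<beta> = "\<lambda>h. act (\<Gamma> (- h)) (\<gamma> (t + h))"] k(2)
      by (simp add: \<Gamma>0 act_one)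
    then have "has_coord_velocity k (\<lambda>h. act (\<Gamma> (- (t + h))) (\<gamma> (t + h))) 0 0"
      using hom[of "- t" "- h" for h] by (simp add: act_mult[symmetric] hom[symmetric])
    then show "\<exists>c\<in>B. has_coord_velocity c (\<lambda>t. act (\<Gamma> (- t)) (\<gamma> t)) t 0"
      using k(1) has_coord_velocity_shift[of k "\<lambda>t. act (\<Gamma> (- t)) (\<gamma> t)" t 0] by blast
  qed simp_all
  then have "act (\<Gamma> t) (act (\<Gamma> (- t)) (\<gamma> t)) = act (\<Gamma> t) (\<gamma> 0)"
    by (simp add: \<Gamma>0 act_one)
  then show ?thesis
    by (simp add: \<Gamma>0 act_one act_mult[symmetric] hom[symmetric])
qed

text \<open>Orbit curves exist for all times, and uniqueness of integral curves fixes the value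
  selected by \<open>THE\<close>. The bounds built from \<open>\<bar>t\<bar> + 1\<close> give an
  open interval around both \<open>0\<close> and \<open>t\<close>.\<close>

lemma flow_fundamental_field:
  assumes \<Gamma>: "one_parameter_subgroup A mul \<Gamma>" "velocity A \<Gamma> 0 = v"
  shows "flow B (fundamental_field A mul B act v) t = act (\<Gamma> t)"
proof
  fix x
  have "\<Gamma> 0 = e"
    by (rule G.one_parameter_subgroup_zero[OF \<Gamma>(1)])
  then have "\<exists>a b \<gamma>. a < 0 \<and> 0 < b \<and> t \<in> {a<..<b} \<and>
      integral_curve B (fundamental_field A mul B act v) {a<..<b} \<gamma> \<and> \<gamma> 0 = x \<and> \<gamma> t = act (\<Gamma> t) x"
    using act_integral_curve[OF \<Gamma>]
    by (intro exI[of _ "- \<bar>t\<bar> - 1"] exI[of _ "\<bar>t\<bar> + 1"] exI[of _ "\<lambda>t. act (\<Gamma> t) x"])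
      (auto simp: act_one)
  then show "flow B (fundamental_field A mul B act v) t x = act (\<Gamma> t) x"
    unfolding flow_def by (rule the_equality) (use integral_curve_unique[OF \<Gamma>] in fastforce)
qed

end

section \<open>Positive densities and the vanishing of the divergence\<close>

lemma smooth_map_const: "smooth_map A model_atlas (\<lambda>x. k)"
  by (simp add: smooth_map_def model_atlas_def smooth_on_def o_def Ck_on_const)

text \<open>Positivity is applied to a basis of \<open>V\<close>, listed as a tuple.\<close>

lemma positive_density_on_nonzero:
  assumes "positive_density_on V \<mu>"
  obtains vs where "vs \<in> tuples V" "\<mu> vs \<noteq> 0"
proof -
  obtain S where S: "S \<subseteq> V" "independent S" "V \<subseteq> span S" "card S = dim V"
    by (rule basis_exists)
  show thesis
  proof (cases "finite S")
    case True
    then obtain vs where "set vs = S" "distinct vs"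
      using finite_distinct_list by blast
    then have "vs \<in> tuples V" "0 < \<mu> vs"
      using S assms(1) by (auto simp: tuples_def positive_density_on_def distinct_card)
    then show thesis
      using that by force
  next
    \<comment> \<open>An infinite basis has \<open>card S = 0\<close>, so \<open>dim V = 0\<close>
      and the only tuple is the empty list, which is vacuously independent.\<close>
    case False
    then have "[] \<in> tuples V"
      using S by (simp add: tuples_def)
    then have "0 < \<mu> []"
      using assms(1) by (auto simp: positive_density_on_def independent_empty)
    then show thesis
      using that[OF \<open>[] \<in> tuples V\<close>] by simp
  qed
qed

text \<open>At each point some tuple has nonzero density, and cancelling it in the defining equation
  leaves zero as the only candidate, so \<open>THE\<close> selects it.\<close>

lemma divergence_eq_zero:
  assumes \<mu>: "smooth_positive_density B \<mu>"
    and zero: "\<And>p vs. vs \<in> tuples (tangent_space B p) \<Longrightarrow> lie_derivative B Y \<mu> p vs = 0"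
  shows "divergence B \<mu> Y = (\<lambda>x. 0)"
  unfolding divergence_def
proof (rule the_equality)
  show "smooth_map B model_atlas (\<lambda>x. 0) \<and>
      (\<forall>p. \<forall>vs\<in>tuples (tangent_space B p). lie_derivative B Y \<mu> p vs = 0 * \<mu> p vs)"
    using zero by (simp add: smooth_map_const)
next
  fix f assume f: "smooth_map B model_atlas f \<and>
      (\<forall>p. \<forall>vs\<in>tuples (tangent_space B p). lie_derivative B Y \<mu> p vs = f p * \<mu> p vs)"
  show "f = (\<lambda>x. 0)"
  proof
    fix p
    obtain vs where vs: "vs \<in> tuples (tangent_space B p)" "\<mu> p vs \<noteq> 0"
      using \<mu> positive_density_on_nonzero unfolding smooth_positive_density_def by metis
    then have "f p * \<mu> p vs = 0"
      using f zero by fastforce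
    with vs(2) show "f p = 0" by simp
  qed
qed

theorem mainTheorem6:
  fixes A :: "('g::{t2_space, second_countable_topology}, 'd::{real_inner, banach}) chart set"
    and mul :: "'g \<Rightarrow> 'g \<Rightarrow> 'g" and e :: 'g and ginv :: "'g \<Rightarrow> 'g"
    and B :: "('m::{t2_space, second_countable_topology}, 'e::{real_inner, banach}) chart set"
    and act :: "'g \<Rightarrow> 'm \<Rightarrow> 'm"
    and \<mu> :: "('m, 'e) density_field"
    and v :: "('g, 'd) tvec"
  assumes "lie_group A mul e ginv"
    and "homogeneous_space A mul e ginv B act"
    and "smooth_positive_density B \<mu>"
    and "invariant_density B act \<mu>"
    and "v \<in> lie_algebra A e"
  shows "divergence B \<mu> (fundamental_field A mul B act v) = (\<lambda>x. 0)"
proof (rule divergence_eq_zero[OF assms(3)])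
  interpret homogeneous_space A mul e ginv B act by fact
  fix p vs assume vs: "vs \<in> tuples (tangent_space B p)"
  obtain \<Gamma> where "one_parameter_subgroup A mul \<Gamma>" "velocity A \<Gamma> 0 = v"
    using G.one_parameter_subgroup_exists[OF assms(5)] .
  then have "pullback B B (flow B (fundamental_field A mul B act v) t) \<mu> p vs = \<mu> p vs" for t
    using assms(4) vs by (simp add: flow_fundamental_field invariant_density_def)
  then show "lie_derivative B (fundamental_field A mul B act v) \<mu> p vs = 0"
    by (simp add: lie_derivative_def)
qed

end
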